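(* For every type-$B$ composition $\alpha$ of $n$, the poset $\mathsf{Tam}_{B}(\alpha)$ is a lattice. Moreover, it is a quotient lattice of the weak order on the parabolic quotient $\mathfrak{H}_{\alpha}$, i.e. there is a lattice congruence $\Theta$ on the lattice $(\mathfrak{H}_{\alpha},\leq_{\mathsf{weak}})$ such that the quotient lattice $(\mathfrak{H}_{\alpha},\leq_{\mathsf{weak}})/\Theta$ is isomorphic to $\mathsf{Tam}_{B}(\alpha)$.
   Context: Let $n\geq 1$ and $\pm[n]=\{-n,\dots,-1,1,\dots,n\}$. The hyperoctahedral group $\mathfrak{H}_n$ is the group of permutations $\pi$ of $\pm[n]$ with $\pi(-a)=-\pi(a)$, with product $(\pi\sigma)(a)=\pi(\sigma(a))$. It is the Coxeter group of type $B_n$ with simple generators $S=\{s_0,\dots,s_{n-1}\}$: $s_0$ exchanges $1$ and $-1$; $s_i$ ($1\le i\le n-1$) exchanges $i$ with $i+1$ and $-i$ with $-i-1$. $\ell_S$ is the Coxeter length. Reflections: $[\![i]\!]$ (exchanging $i,-i$), and for $0<i<j$, $(\!(i\;j)\!)$ (exchanging $i,j$ and $-i,-j$) and $(\!(-j\;i)\!)$ (exchanging $-j,i$ and $j,-i$). The inversion set is $\mathsf{Inv}(\pi)=\{t:\ell_S(\pi t)<\ell_S(\pi)\}$; explicitly $[\![i]\!]\in\mathsf{Inv}(\pi)$ iff $\pi(i)<0$, $(\!(i\;j)\!)\in\mathsf{Inv}(\pi)$ iff $\pi(i)>\pi(j)$, $(\!(-j\;i)\!)\in\mathsf{Inv}(\pi)$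 iff $\pi(-j)>\pi(i)$ ($0<i<j$). The (left) weak order is $u\leq_{\mathsf{weak}}v$ iff $\ell_S(u)+\ell_S(vu^{-1})=\ell_S(v)$, equivalently $\mathsf{Inv}(u)\subseteq\mathsf{Inv}(v)$. A type-$B$ composition of $n$ is a sequence $(\alpha_1,\dots,\alpha_r)$ of positive integers summing to $n$, possibly preceded by an extra component $0$; it is split if the $0$ is present and join otherwise. Let $p_0=0$, $p_i=\alpha_1+\cdots+\alpha_i$. Let $J_\alpha=\{s_{p_1},\dots,s_{p_{r-1}}\}$, together with $s_0$ if $\alpha$ is split, and $\mathfrak{H}_\alpha=\{w\in\mathfrak{H}_n:\ell_S(ws)>\ell_S(w)\ \forall s\in S\setminus J_\alpha\}$ (minimal length coset representatives); $\mathfrak{H}_\alpha$ carries the restricted weak order. Let $\mathsf{Part}(\alpha)$ be the partition of $\pm[n]$ into the blocks $\{p_{i-1}+1,\dots,p_i\}$ and $\{-p_i,\dots,-p_{i-1}-1\}$, $1\le i\le r$, except that if $\alpha$ is join the two blocks for $i=1$ are merged into $\{-p_1,\dots,p_1\}\setminus\{0\}$. (Equivalently, $\pi\in\mathfrak{H}_\alpha$ iff $\pi$ is increasing on each block.) For $x\in\pm[n]$ put $x^+=x+1$ if $x\neq-1$ and $(-1)^+=1$. If $\alpha$ is split, a type-$B$ $(\alpha,231)$-split pattern of $\pi\in\mathfrak{H}_\alpha$ is a triple $i<j<k$ in $\pm[n]$ lying in pairwise different blocks of $\mathsf{Part}(\alpha)$ with $j>0$, $\pi(i)=\pi(k)^+$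 and $\pi(i)<\pi(j)$. If $\alpha$ is join, a type-$B$ $(\alpha,231)$-join pattern is a triple $i<j<k$ in $\pm[n]$ in pairwise different blocks with $j>0$, $\pi(i)=\pi(k)^+$, and either ($j>\alpha_1$ and $\pi(j)>\pi(i)$) or ($0<j\le\alpha_1$ and $\pi(j)<\pi(k)$). $\mathfrak{H}_\alpha(231)$ is the set of $\pi\in\mathfrak{H}_\alpha$ having no such split pattern (if $\alpha$ split) resp. join pattern (if $\alpha$ join), and $\mathsf{Tam}_B(\alpha)=(\mathfrak{H}_\alpha(231),\leq_{\mathsf{weak}})$. *)

theory Defs
  imports "HOL-Algebra.Lattice" "HOL-Combinatorics.Permutations"
begin

section \<open>The hyperoctahedral group as a Coxeter group\<close>

definition pm :: "nat \<Rightarrow> int set"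
  where "pm n = {- int n..int n} - {0}"

text \<open>Signed permutations are functions on all of \<^typ>\<open>int\<close> that fix every point outside
  \<^term>\<open>pm n\<close>; the group operation is composition of functions.\<close>

definition hyperoctahedral :: "nat \<Rightarrow> (int \<Rightarrow> int) set"
  where "hyperoctahedral n = {\<pi>. \<pi> permutes pm n \<and> (\<forall>a\<in>pm n. \<pi> (- a) = - \<pi> a)}"

definition simple_gen :: "nat \<Rightarrow> int \<Rightarrow> int"
  where "simple_gen i =
    (if i = 0 then transpose (- 1) 1
     else transpose (int i) (int i + 1) \<circ> transpose (- int i) (- int i - 1))"

definition simple_gens :: "nat \<Rightarrow> (int \<Rightarrow> int) set"
  where "simple_gens n = simple_gen ` {..<n}"

definition cox_length :: "nat \<Rightarrow> (int \<Rightarrow> int) \<Rightarrow> nat"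
  where "cox_length n \<pi> =
    (LEAST k. \<exists>ws. length ws = k \<and> set ws \<subseteq> simple_gens n \<and> \<pi> = foldr (\<circ>) ws id)"

definition weak_le :: "nat \<Rightarrow> (int \<Rightarrow> int) \<Rightarrow> (int \<Rightarrow> int) \<Rightarrow> bool"
  where "weak_le n u v \<longleftrightarrow> cox_length n u + cox_length n (v \<circ> inv u) = cox_length n v"

section \<open>Type B compositions and parabolic quotients\<close>

text \<open>A type B composition is a list of naturals in which only the first entry may be \<open>0\<close>;
  it is split if that leading \<open>0\<close> is present, and join otherwise.\<close>

definition typeB_composition :: "nat \<Rightarrow> nat list \<Rightarrow> bool"
  where "typeB_composition n \<alpha> \<longleftrightarrow> sum_list \<alpha> = n \<and> (\<forall>a\<in>set (tl \<alpha>). 0 < a)"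

definition is_split :: "nat list \<Rightarrow> bool"
  where "is_split \<alpha> \<longleftrightarrow> \<alpha> \<noteq> [] \<and> hd \<alpha> = 0"

text \<open>The positive entries \<open>(\<alpha>\<^sub>1, \<dots>, \<alpha>\<^sub>r)\<close>, without the optional leading \<open>0\<close>.\<close>

definition parts :: "nat list \<Rightarrow> nat list"
  where "parts \<alpha> = (if is_split \<alpha> then tl \<alpha> else \<alpha>)"

definition psum :: "nat list \<Rightarrow> nat \<Rightarrow> nat"
  where "psum \<alpha> i = sum_list (take i (parts \<alpha>))"

definition J_gens :: "nat list \<Rightarrow> (int \<Rightarrow> int) set"
  where "J_gens \<alpha> =
    {simple_gen (psum \<alpha> i) | i. 1 \<le> i \<and> i < length (parts \<alpha>)}
    \<union> (if is_split \<alpha> then {simple_gen 0} else {})"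

definition parabolic_quotient :: "nat \<Rightarrow> nat list \<Rightarrow> (int \<Rightarrow> int) set"
  where "parabolic_quotient n \<alpha> =
    {w \<in> hyperoctahedral n.
       \<forall>s \<in> simple_gens n - J_gens \<alpha>. cox_length n (w \<circ> s) > cox_length n w}"

definition weak_order_on :: "nat \<Rightarrow> (int \<Rightarrow> int) set \<Rightarrow> (int \<Rightarrow> int) gorder"
  where "weak_order_on n A = \<lparr>carrier = A, eq = (=), le = weak_le n\<rparr>"

section \<open>Pattern avoidance and the parabolic Tamari posets\<close>

definition pos_block :: "nat list \<Rightarrow> nat \<Rightarrow> int set"
  where "pos_block \<alpha> i = {int (psum \<alpha> (i - 1)) + 1..int (psum \<alpha> i)}"

definition neg_block :: "nat list \<Rightarrow> nat \<Rightarrow> int set"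
  where "neg_block \<alpha> i = {- int (psum \<alpha> i)..- int (psum \<alpha> (i - 1)) - 1}"

definition Part :: "nat list \<Rightarrow> int set set"
  where "Part \<alpha> =
    (if is_split \<alpha>
     then pos_block \<alpha> ` {1..length (parts \<alpha>)} \<union> neg_block \<alpha> ` {1..length (parts \<alpha>)}
     else {{- int (psum \<alpha> 1)..int (psum \<alpha> 1)} - {0}}
          \<union> pos_block \<alpha> ` {2..length (parts \<alpha>)} \<union> neg_block \<alpha> ` {2..length (parts \<alpha>)})"

definition in_different_blocks :: "nat list \<Rightarrow> int \<Rightarrow> int \<Rightarrow> int \<Rightarrow> bool"
  where "in_different_blocks \<alpha> i j k \<longleftrightarrow>
    (\<exists>A\<in>Part \<alpha>. \<exists>B\<in>Part \<alpha>. \<exists>C\<in>Part \<alpha>.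
       A \<noteq> B \<and> A \<noteq> C \<and> B \<noteq> C \<and> i \<in> A \<and> j \<in> B \<and> k \<in> C)"

definition succ_pm :: "int \<Rightarrow> int"
  where "succ_pm x = (if x = - 1 then 1 else x + 1)"

definition split_pattern :: "nat \<Rightarrow> nat list \<Rightarrow> (int \<Rightarrow> int) \<Rightarrow> int \<Rightarrow> int \<Rightarrow> int \<Rightarrow> bool"
  where "split_pattern n \<alpha> \<pi> i j k \<longleftrightarrow>
    i \<in> pm n \<and> j \<in> pm n \<and> k \<in> pm n \<and> i < j \<and> j < k \<and> in_different_blocks \<alpha> i j k \<and>
    j > 0 \<and> \<pi> i = succ_pm (\<pi> k) \<and> \<pi> i < \<pi> j"

definition join_pattern :: "nat \<Rightarrow> nat list \<Rightarrow> (int \<Rightarrow> int) \<Rightarrow> int \<Rightarrow> int \<Rightarrow> int \<Rightarrow> bool"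
  where "join_pattern n \<alpha> \<pi> i j k \<longleftrightarrow>
    i \<in> pm n \<and> j \<in> pm n \<and> k \<in> pm n \<and> i < j \<and> j < k \<and> in_different_blocks \<alpha> i j k \<and>
    j > 0 \<and> \<pi> i = succ_pm (\<pi> k) \<and>
    (j > int (psum \<alpha> 1) \<and> \<pi> j > \<pi> i \<or> 0 < j \<and> j \<le> int (psum \<alpha> 1) \<and> \<pi> j < \<pi> k)"

definition avoiders231 :: "nat \<Rightarrow> nat list \<Rightarrow> (int \<Rightarrow> int) set"
  where "avoiders231 n \<alpha> =
    {\<pi> \<in> parabolic_quotient n \<alpha>.
       if is_split \<alpha> then \<not> (\<exists>i j k. split_pattern n \<alpha> \<pi> i j k)
       else \<not> (\<exists>i j k. join_pattern n \<alpha> \<pi> i j k)}"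

definition Tam_B :: "nat \<Rightarrow> nat list \<Rightarrow> (int \<Rightarrow> int) gorder"
  where "Tam_B n \<alpha> = weak_order_on n (avoiders231 n \<alpha>)"

section \<open>Lattice congruences and quotient lattices\<close>

definition lattice_congruence :: "('a, 'm) gorder_scheme \<Rightarrow> 'a rel \<Rightarrow> bool"
  where "lattice_congruence L \<Theta> \<longleftrightarrow>
    equiv (carrier L) \<Theta> \<and>
    (\<forall>x x' y y'. (x, x') \<in> \<Theta> \<longrightarrow> (y, y') \<in> \<Theta> \<longrightarrow>
       (x \<squnion>\<^bsub>L\<^esub> y, x' \<squnion>\<^bsub>L\<^esub> y') \<in> \<Theta> \<and> (x \<sqinter>\<^bsub>L\<^esub> y, x' \<sqinter>\<^bsub>L\<^esub> y') \<in> \<Theta>)"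

text \<open>The order of the quotient lattice. The lemmas below confirm that its joins and meets are
  the operations induced on the congruence classes.\<close>

definition quotient_lattice :: "('a, 'm) gorder_scheme \<Rightarrow> 'a rel \<Rightarrow> 'a set gorder"
  where "quotient_lattice L \<Theta> =
    \<lparr>carrier = carrier L // \<Theta>, eq = (=), le = (\<lambda>X Y. \<exists>x\<in>X. \<exists>y\<in>Y. x \<sqsubseteq>\<^bsub>L\<^esub> y)\<rparr>"

definition order_isomorphic :: "('a, 'm) gorder_scheme \<Rightarrow> ('b, 'k) gorder_scheme \<Rightarrow> bool"
  where "order_isomorphic L M \<longleftrightarrow>
    (\<exists>f. bij_betw f (carrier L) (carrier M) \<and>
         (\<forall>x\<in>carrier L. \<forall>y\<in>carrier L. x \<sqsubseteq>\<^bsub>L\<^esub> y \<longleftrightarrow> f x \<sqsubseteq>\<^bsub>M\<^esub> f y))"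

locale lattice_with_congruence = lattice L for L :: "('a, 'm) gorder_scheme" (structure) +
  fixes \<Theta> :: "'a rel"
  assumes congruence: "lattice_congruence L \<Theta>"
begin

lemma equiv_cong: "equiv (carrier L) \<Theta>"
  using congruence by (simp add: lattice_congruence_def)

lemma cong_refl: "x \<in> carrier L \<Longrightarrow> (x, x) \<in> \<Theta>"
  using equiv_cong by (simp add: equiv_def refl_on_def)

lemma cong_sym: "(x, y) \<in> \<Theta> \<Longrightarrow> (y, x) \<in> \<Theta>"
  using equiv_cong by (meson equiv_def symD)

lemma cong_trans: "(x, y) \<in> \<Theta> \<Longrightarrow> (y, z) \<in> \<Theta> \<Longrightarrow> (x, z) \<in> \<Theta>"
  using equiv_cong by (meson equiv_def transD)

lemma cong_carrier: "(x, y) \<in> \<Theta> \<Longrightarrow> x \<in> carrier L" "(x, y) \<in> \<Theta> \<Longrightarrow> y \<in> carrier L"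
  using equiv_cong by (auto simp: equiv_def)

lemma cong_join: "(x, x') \<in> \<Theta> \<Longrightarrow> (y, y') \<in> \<Theta> \<Longrightarrow> (x \<squnion> y, x' \<squnion> y') \<in> \<Theta>"
  and cong_meet: "(x, x') \<in> \<Theta> \<Longrightarrow> (y, y') \<in> \<Theta> \<Longrightarrow> (x \<sqinter> y, x' \<sqinter> y') \<in> \<Theta>"
  using congruence by (simp_all add: lattice_congruence_def)

lemma class_le_iff:
  "\<Theta> `` {x} \<sqsubseteq>\<^bsub>quotient_lattice L \<Theta>\<^esub> \<Theta> `` {y} \<longleftrightarrow> (\<exists>a b. (x, a) \<in> \<Theta> \<and> (y, b) \<in> \<Theta> \<and> a \<sqsubseteq> b)"
  by (auto simp: quotient_lattice_def)

lemma class_le_iff_join: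
  assumes x: "x \<in> carrier L" and y: "y \<in> carrier L"
  shows "\<Theta> `` {x} \<sqsubseteq>\<^bsub>quotient_lattice L \<Theta>\<^esub> \<Theta> `` {y} \<longleftrightarrow> (x \<squnion> y, y) \<in> \<Theta>"
proof
  assume "\<Theta> `` {x} \<sqsubseteq>\<^bsub>quotient_lattice L \<Theta>\<^esub> \<Theta> `` {y}"
  then obtain a b where ab: "(x, a) \<in> \<Theta>" "(y, b) \<in> \<Theta>" "a \<sqsubseteq> b"
    by (auto simp: class_le_iff)
  then have "a \<squnion> b = b"
    using le_iff_meet cong_carrier(2) by blast
  then show "(x \<squnion> y, y) \<in> \<Theta>"
    using cong_join[OF ab(1,2)] cong_sym[OF ab(2)] cong_trans by simp
next
  assume "(x \<squnion> y, y) \<in> \<Theta>"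
  then show "\<Theta> `` {x} \<sqsubseteq>\<^bsub>quotient_lattice L \<Theta>\<^esub> \<Theta> `` {y}"
    using cong_sym cong_refl[OF x] join_left[OF x y] by (auto simp: class_le_iff)
qed

lemma class_le_iff_meet:
  assumes x: "x \<in> carrier L" and y: "y \<in> carrier L"
  shows "\<Theta> `` {x} \<sqsubseteq>\<^bsub>quotient_lattice L \<Theta>\<^esub> \<Theta> `` {y} \<longleftrightarrow> (x \<sqinter> y, x) \<in> \<Theta>"
proof
  assume "\<Theta> `` {x} \<sqsubseteq>\<^bsub>quotient_lattice L \<Theta>\<^esub> \<Theta> `` {y}"
  then obtain a b where ab: "(x, a) \<in> \<Theta>" "(y, b) \<in> \<Theta>" "a \<sqsubseteq> b"
    by (auto simp: class_le_iff)
  then have "a \<sqinter> b = a"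
    using le_iff_join[of a b] cong_carrier(2) by metis
  then show "(x \<sqinter> y, x) \<in> \<Theta>"
    using cong_meet[OF ab(1,2)] cong_sym[OF ab(1)] cong_trans by simp
next
  assume "(x \<sqinter> y, x) \<in> \<Theta>"
  then show "\<Theta> `` {x} \<sqsubseteq>\<^bsub>quotient_lattice L \<Theta>\<^esub> \<Theta> `` {y}"
    using cong_sym cong_refl[OF y] meet_right[OF x y] by (auto simp: class_le_iff)
qed

lemma carrier_quotient: "carrier (quotient_lattice L \<Theta>) = carrier L // \<Theta>"
  by (simp add: quotient_lattice_def)

lemma class_in_quotient: "x \<in> carrier L \<Longrightarrow> \<Theta> `` {x} \<in> carrier (quotient_lattice L \<Theta>)"
  by (simp add: carrier_quotient quotientI)

lemma class_leI:
  "x \<in> carrier L \<Longrightarrow> y \<in> carrier L \<Longrightarrow> x \<sqsubseteq> y \<Longrightarrow> \<Theta> `` {x} \<sqsubseteq>\<^bsub>quotient_lattice L \<Theta>\<^esub> \<Theta> `` {y}"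
  using cong_refl by (auto simp: class_le_iff)

lemma quotient_partial_order: "partial_order (quotient_lattice L \<Theta>)"
proof (unfold_locales, goal_cases)
  case (4 X)
  then show ?case
    by (auto simp: carrier_quotient elim!: quotientE intro!: class_leI)
next
  case (5 X Y)
  then obtain x y where xy: "x \<in> carrier L" "y \<in> carrier L" "X = \<Theta> `` {x}" "Y = \<Theta> `` {y}"
    by (auto simp: carrier_quotient elim!: quotientE)
  then have "(x \<squnion> y, y) \<in> \<Theta>" "(x \<squnion> y, x) \<in> \<Theta>"
    using 5 by (simp_all add: class_le_iff_join join_comm[of L y x])
  then have "(x, y) \<in> \<Theta>"
    using cong_sym cong_trans by blast
  then show ?case
    using equiv_class_eq[OF equiv_cong] xy by (simp add: quotient_lattice_def)
next
  case (6 X Y Z)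
  then obtain x y z where xyz: "x \<in> carrier L" "y \<in> carrier L" "z \<in> carrier L"
    "X = \<Theta> `` {x}" "Y = \<Theta> `` {y}" "Z = \<Theta> `` {z}"
    by (auto simp: carrier_quotient elim!: quotientE)
  then have 1: "(x \<squnion> y, y) \<in> \<Theta>" and 2: "(y \<squnion> z, z) \<in> \<Theta>"
    using 6 by (simp_all add: class_le_iff_join)
  have "(x \<squnion> z, x \<squnion> (y \<squnion> z)) \<in> \<Theta>"
    using cong_join[OF cong_refl[OF xyz(1)] cong_sym[OF 2]] .
  moreover have "x \<squnion> (y \<squnion> z) = (x \<squnion> y) \<squnion> z"
    using xyz weak_join_assoc by (simp add: eq_is_equal)
  moreover have "((x \<squnion> y) \<squnion> z, y \<squnion> z) \<in> \<Theta>"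
    using cong_join[OF 1 cong_refl[OF xyz(3)]] .
  ultimately have "(x \<squnion> z, z) \<in> \<Theta>"
    using 2 cong_trans by metis
  then show ?case
    using xyz by (simp add: class_le_iff_join)
qed (auto simp: quotient_lattice_def)

lemma quotient_is_lub:
  assumes x: "x \<in> carrier L" and y: "y \<in> carrier L"
  shows "is_lub (quotient_lattice L \<Theta>) (\<Theta> `` {x \<squnion> y}) {\<Theta> `` {x}, \<Theta> `` {y}}"
proof -
  have "\<Theta> `` {x \<squnion> y} \<sqsubseteq>\<^bsub>quotient_lattice L \<Theta>\<^esub> Z"
    if Z: "Z \<in> carrier (quotient_lattice L \<Theta>)" "\<Theta> `` {x} \<sqsubseteq>\<^bsub>quotient_lattice L \<Theta>\<^esub> Z"
      "\<Theta> `` {y} \<sqsubseteq>\<^bsub>quotient_lattice L \<Theta>\<^esub> Z" for Z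
  proof -
    obtain z where z: "z \<in> carrier L" "Z = \<Theta> `` {z}"
      using Z by (auto simp: carrier_quotient elim!: quotientE)
    then have 1: "(x \<squnion> z, z) \<in> \<Theta>" and 2: "(y \<squnion> z, z) \<in> \<Theta>"
      using that x y by (simp_all add: class_le_iff_join)
    have "(x \<squnion> (y \<squnion> z), x \<squnion> z) \<in> \<Theta>"
      using cong_join[OF cong_refl[OF x] 2] .
    moreover have "x \<squnion> (y \<squnion> z) = (x \<squnion> y) \<squnion> z"
      using x y z weak_join_assoc by (simp add: eq_is_equal)
    ultimately have "((x \<squnion> y) \<squnion> z, z) \<in> \<Theta>"
      using 1 cong_trans by metis
    then show ?thesis
      using x y z by (simp add: class_le_iff_join)
  qed
  then show ?thesis
    using x y by (auto simp: least_def Upper_def class_in_quotient intro!: class_leI join_left join_right)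
qed

lemma quotient_is_glb:
  assumes x: "x \<in> carrier L" and y: "y \<in> carrier L"
  shows "is_glb (quotient_lattice L \<Theta>) (\<Theta> `` {x \<sqinter> y}) {\<Theta> `` {x}, \<Theta> `` {y}}"
proof -
  have "Z \<sqsubseteq>\<^bsub>quotient_lattice L \<Theta>\<^esub> \<Theta> `` {x \<sqinter> y}"
    if Z: "Z \<in> carrier (quotient_lattice L \<Theta>)" "Z \<sqsubseteq>\<^bsub>quotient_lattice L \<Theta>\<^esub> \<Theta> `` {x}"
      "Z \<sqsubseteq>\<^bsub>quotient_lattice L \<Theta>\<^esub> \<Theta> `` {y}" for Z
  proof -
    obtain z where z: "z \<in> carrier L" "Z = \<Theta> `` {z}"
      using Z by (auto simp: carrier_quotient elim!: quotientE)
    then have 1: "(z \<sqinter> x, z) \<in> \<Theta>" and 2: "(z \<sqinter> y, z) \<in> \<Theta>"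
      using that x y by (simp_all add: class_le_iff_meet)
    have "((z \<sqinter> x) \<sqinter> y, z \<sqinter> y) \<in> \<Theta>"
      using cong_meet[OF 1 cong_refl[OF y]] .
    moreover have "z \<sqinter> (x \<sqinter> y) = (z \<sqinter> x) \<sqinter> y"
      using x y z weak_meet_assoc by (simp add: eq_is_equal)
    ultimately have "(z \<sqinter> (x \<sqinter> y), z) \<in> \<Theta>"
      using 2 cong_trans by metis
    then show ?thesis
      using x y z by (simp add: class_le_iff_meet)
  qed
  then show ?thesis
    using x y by (auto simp: greatest_def Lower_def class_in_quotient intro!: class_leI meet_left meet_right)
qed

lemma lattice_quotient: "lattice (quotient_lattice L \<Theta>)"
proof -
  interpret Q: partial_order "quotient_lattice L \<Theta>"
    by (rule quotient_partial_order)
  show ?thesis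
  proof (unfold_locales, goal_cases)
    case (1 X Y)
    then show ?case
      using quotient_is_lub by (auto simp: carrier_quotient elim!: quotientE)
  next
    case (2 X Y)
    then show ?case
      using quotient_is_glb by (auto simp: carrier_quotient elim!: quotientE)
  qed
qed

lemma quotient_join:
  assumes "x \<in> carrier L" and "y \<in> carrier L"
  shows "\<Theta> `` {x} \<squnion>\<^bsub>quotient_lattice L \<Theta>\<^esub> \<Theta> `` {y} = \<Theta> `` {x \<squnion> y}"
proof -
  interpret Q: lattice "quotient_lattice L \<Theta>"
    by (rule lattice_quotient)
  show ?thesis
    unfolding join_def[of "quotient_lattice L \<Theta>"] sup_def
    using quotient_is_lub[OF assms] by (metis (no_types, lifting) Q.least_unique someI_ex)
qed

lemma quotient_meet:
  assumes "x \<in> carrier L" and "y \<in> carrier L"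
  shows "\<Theta> `` {x} \<sqinter>\<^bsub>quotient_lattice L \<Theta>\<^esub> \<Theta> `` {y} = \<Theta> `` {x \<sqinter> y}"
proof -
  interpret Q: lattice "quotient_lattice L \<Theta>"
    by (rule lattice_quotient)
  show ?thesis
    unfolding meet_def[of "quotient_lattice L \<Theta>"] inf_def
    using quotient_is_glb[OF assms] by (metis (no_types, lifting) Q.greatest_unique someI_ex)
qed

end

end

theory Submission
  imports Defs
begin

text \<open>
  Record a signed permutation by all its inversions on \<open>\<plusminus>[n]\<close>, i.e. the pairs of positions
  \<open>i < k\<close> with \<open>\<pi> i > \<pi> k\<close>. The weak order is inclusion of these sets, and joins are
  transitive closures of unions.

  A cover of the weak order swaps two adjacent values, at positions \<open>i < k\<close>. Call it contracted
  if some \<open>j\<close> between \<open>i\<close> and \<open>k\<close> turns it into a pattern; the side on which \<open>j\<close> must lie depends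
  on \<open>j\<close> only. The avoiders are the elements without contracted lower cover, and there are dually
  the elements without contracted upper cover. If \<open>x\<close> covers \<open>y\<close> by a contracted cover, an
  avoider below \<open>x\<close> is already below \<open>y\<close>, and dually. Hence descending along contracted covers
  computes the greatest avoider below an element, ascending computes the least dual avoider above
  it, and both projections have the same kernel. Such a kernel is a lattice congruence.
\<close>

section \<open>Signed permutations and their inversions\<close>

text \<open>A cover of the left weak order exchanges values and leaves positions in place, so blocks
  and middle positions of patterns are fixed data, and all else is read off from comparisons between
  positions. With pairs taken over all of \<open>pm n\<close>, inversion sets are exactly the
  transitive and cotransitive sets of increasing pairs that are stable under negation: type B
  becomes type A together with a symmetry. Two obstacles shape the argument. Patterns demand
  adjacent values, so it is not evident how avoidance at one element bears on the elements above it;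
  and a congruence usually calls for an analysis of which contracted covers force others. Both are
  met by one observation: the condition for contracting a cover at \<open>i\<close>,
  \<open>k\<close> only compares \<open>i\<close> and \<open>k\<close> with a third position
  \<open>j\<close>, and the two ends of the cover agree on these comparisons. The same obstruction
  can therefore be used from above against avoiders and from below against dual avoiders, and these
  two local facts already tie the kernels of the two projections together.\<close>

lemma mem_pm: "x \<in> pm n \<longleftrightarrow> x \<noteq> 0 \<and> - int n \<le> x \<and> x \<le> int n"
  by (auto simp: pm_def)

lemma finite_pm: "finite (pm n)"
  by (simp add: pm_def)

lemma uminus_mem_pm [simp]: "- x \<in> pm n \<longleftrightarrow> x \<in> pm n"
  by (auto simp: mem_pm)

lemma less_succ_pm: "x < succ_pm x"
  by (simp add: succ_pm_def)

lemma succ_pm_le: "x < y \<Longrightarrow> y \<noteq> 0 \<Longrightarrow> succ_pm x \<le> y"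
  by (simp add: succ_pm_def)

lemma succ_pm_in_pm: "x \<in> pm n \<Longrightarrow> y \<in> pm n \<Longrightarrow> x < y \<Longrightarrow> succ_pm x \<in> pm n"
  by (auto simp: mem_pm succ_pm_def)

lemma succ_pm_uminus_succ_pm: "x \<noteq> 0 \<Longrightarrow> succ_pm (- succ_pm x) = - x"
  by (auto simp: succ_pm_def)

text \<open>A discrete intermediate value principle, with steps by \<open>succ_pm\<close> so that 0
  is skipped. It serves on values, to find adjacent values whose positions jump, and on positions,
  to find an adjacent descent.\<close>

lemma pm_walk:
  assumes "u \<in> pm n" "v \<in> pm n" "u < v" "P u" "\<not> P v"
  obtains w where "w \<in> pm n" "succ_pm w \<in> pm n" "u \<le> w" "succ_pm w \<le> v" "P w" "\<not> P (succ_pm w)"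
proof -
  have "\<exists>w\<in>pm n. succ_pm w \<in> pm n \<and> u \<le> w \<and> succ_pm w \<le> v \<and> P w \<and> \<not> P (succ_pm w)"
    using assms
  proof (induction "nat (v - u)" arbitrary: u rule: less_induct)
    case less
    show ?case
    proof (cases "P (succ_pm u)")
      case True
      have "succ_pm u \<le> v"
        using less.prems by (auto simp: mem_pm intro: succ_pm_le)
      with True less.prems have "succ_pm u < v"
        by (cases "succ_pm u = v") auto
      then show ?thesis
        using less.hyps[of "succ_pm u"] less_succ_pm[of u] less.prems True succ_pm_in_pm[of u n v]
        by fastforce
    next
      case False
      then show ?thesis
        using less.prems succ_pm_in_pm[of u n v] succ_pm_le[of u v] by (auto simp: mem_pm)
    qed
  qed
  then show ?thesis
    using that by blast
qed

text \<open>Points outside \<open>pm n\<close> are fixed, so oddness extends to all integers and can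
  be rewritten with under no membership condition.\<close>

lemma hyperoctahedral_iff:
  "\<pi> \<in> hyperoctahedral n \<longleftrightarrow> \<pi> permutes pm n \<and> (\<forall>a. \<pi> (- a) = - \<pi> a)"
proof -
  have "\<pi> (- a) = - \<pi> a" if "\<pi> permutes pm n" "\<forall>a\<in>pm n. \<pi> (- a) = - \<pi> a" for a
    using that permutes_not_in[of \<pi> "pm n" a] permutes_not_in[of \<pi> "pm n" "- a"]
    by (cases "a \<in> pm n") auto
  then show ?thesis
    by (auto simp: hyperoctahedral_def)
qed

lemma hyperoctahedral_permutes: "\<pi> \<in> hyperoctahedral n \<Longrightarrow> \<pi> permutes pm n"
  and hyperoctahedral_uminus: "\<pi> \<in> hyperoctahedral n \<Longrightarrow> \<pi> (- a) = - \<pi> a"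
  by (simp_all add: hyperoctahedral_iff)

lemma hyperoctahedral_mem_pm: "\<pi> \<in> hyperoctahedral n \<Longrightarrow> \<pi> a \<in> pm n \<longleftrightarrow> a \<in> pm n"
  by (simp add: hyperoctahedral_permutes permutes_in_image)

lemma hyperoctahedral_eq_iff: "\<pi> \<in> hyperoctahedral n \<Longrightarrow> \<pi> a = \<pi> b \<longleftrightarrow> a = b"
  by (metis hyperoctahedral_permutes permutes_inj injD)

lemma hyperoctahedral_surj:
  assumes "\<pi> \<in> hyperoctahedral n" "x \<in> pm n"
  obtains a where "a \<in> pm n" "\<pi> a = x"
  using assms hyperoctahedral_permutes permutes_image by (metis imageE)

lemma id_hyperoctahedral: "id \<in> hyperoctahedral n"
  by (simp add: hyperoctahedral_iff permutes_id)

lemma comp_hyperoctahedral: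
  "\<pi> \<in> hyperoctahedral n \<Longrightarrow> \<sigma> \<in> hyperoctahedral n \<Longrightarrow> \<pi> \<circ> \<sigma> \<in> hyperoctahedral n"
  by (simp add: hyperoctahedral_iff permutes_compose)

lemma inv_hyperoctahedral: "\<pi> \<in> hyperoctahedral n \<Longrightarrow> inv \<pi> \<in> hyperoctahedral n"
  unfolding hyperoctahedral_iff
  by (metis permutes_inv permutes_inverses(1) permutes_inverses(2))

text \<open>Naming a generator after the lower of two adjacent values treats the sign change,
  \<open>x = -1\<close>, like all the others. There the two exchanged pairs coincide, and the first
  two branches decide.\<close>

definition adj_swap :: "int \<Rightarrow> int \<Rightarrow> int"
  where "adj_swap x z =
    (if z = x then succ_pm x else if z = succ_pm x then x
     else if z = - x then - succ_pm x else if z = - succ_pm x then - x else z)"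

lemma adj_swap_involutive: "x \<noteq> 0 \<Longrightarrow> adj_swap x (adj_swap x z) = z"
  by (auto simp: adj_swap_def succ_pm_def split: if_splits)

lemma adj_swap_comp_self: "x \<noteq> 0 \<Longrightarrow> adj_swap x \<circ> adj_swap x = id"
  by (simp add: fun_eq_iff adj_swap_involutive)

text \<open>No nonzero integer lies strictly between \<open>x\<close> and \<open>succ_pm x\<close>,
  so exchanging these neighbours can reverse only their own pair and its mirror image.\<close>

lemma adj_swap_less:
  assumes "x \<noteq> 0" "u \<noteq> 0" "v \<noteq> 0" "u < v" "(u, v) \<noteq> (x, succ_pm x)" "(u, v) \<noteq> (- succ_pm x, - x)"
  shows "adj_swap x u < adj_swap x v"
proof (cases "x = -1")
  case True
  then show ?thesis
    using assms by (auto simp: adj_swap_def succ_pm_def split: if_splits)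
next
  case False
  then show ?thesis
    using assms by (auto simp: adj_swap_def succ_pm_def split: if_splits)
qed

lemma adj_swap_hyperoctahedral:
  assumes "x \<in> pm n" "succ_pm x \<in> pm n"
  shows "adj_swap x \<in> hyperoctahedral n"
proof -
  have x: "x \<noteq> 0"
    using assms by (simp add: mem_pm)
  have "adj_swap x permutes pm n"
    unfolding permutes_def
  proof (intro conjI allI impI)
    fix z assume "z \<notin> pm n"
    then show "adj_swap x z = z"
      using assms by (auto simp: adj_swap_def)
  next
    fix y
    show "\<exists>!z. adj_swap x z = y"
      using adj_swap_involutive[OF x] by metis
  qed
  moreover have "adj_swap x (- a) = - adj_swap x a" for a
    using x by (auto simp: adj_swap_def succ_pm_def)
  ultimately show ?thesis
    by (simp add: hyperoctahedral_iff)
qed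

lemma simple_gen_eq_adj_swap:
  "simple_gen m = adj_swap (if m = 0 then - 1 else int m)"
  by (auto simp: fun_eq_iff simple_gen_def adj_swap_def succ_pm_def transpose_def)

lemma adj_swap_uminus_succ_pm: "x \<noteq> 0 \<Longrightarrow> adj_swap (- succ_pm x) = adj_swap x"
  by (auto simp: fun_eq_iff adj_swap_def succ_pm_def)

lemma simple_gens_eq: "simple_gens n = adj_swap ` {x \<in> pm n. succ_pm x \<in> pm n}"
proof (intro equalityI subsetI)
  fix s assume "s \<in> simple_gens n"
  then obtain m where "m < n" "s = simple_gen m"
    by (auto simp: simple_gens_def)
  then show "s \<in> adj_swap ` {x \<in> pm n. succ_pm x \<in> pm n}"
    by (auto simp: simple_gen_eq_adj_swap mem_pm succ_pm_def)
next
  fix s assume "s \<in> adj_swap ` {x \<in> pm n. succ_pm x \<in> pm n}"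
  then obtain x where x: "x \<in> pm n" "succ_pm x \<in> pm n" "s = adj_swap x"
    by blast
  consider "x = - 1" | "x > 0" | "x < - 1"
    using x by (force simp: mem_pm)
  then show "s \<in> simple_gens n"
  proof cases
    case 1
    then have "s = simple_gen 0" "0 < n"
      using x by (auto simp: simple_gen_eq_adj_swap mem_pm succ_pm_def)
    then show ?thesis
      by (simp add: simple_gens_def)
  next
    case 2
    then have "s = simple_gen (nat x)" "nat x < n"
      using x by (auto simp: simple_gen_eq_adj_swap mem_pm succ_pm_def)
    then show ?thesis
      by (simp add: simple_gens_def)
  next
    case 3
    \<comment> \<open>An exchange of two negative values is renamed after its positive mirror pair,
      whose lower member is \<open>- succ_pm x\<close>.\<close>
    then have "s = adj_swap (- succ_pm x)"
      using x by (simp add: adj_swap_uminus_succ_pm)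
    then have "s = simple_gen (nat (- succ_pm x))" "nat (- succ_pm x) < n"
      using 3 x by (auto simp: simple_gen_eq_adj_swap mem_pm succ_pm_def)
    then show ?thesis
      by (simp add: simple_gens_def)
  qed
qed

definition invs :: "nat \<Rightarrow> (int \<Rightarrow> int) \<Rightarrow> (int \<times> int) set"
  where "invs n \<pi> = {(i, k). i \<in> pm n \<and> k \<in> pm n \<and> i < k \<and> \<pi> k < \<pi> i}"

text \<open>The pairs \<open>(i, k)\<close> and \<open>(-k, -i)\<close> stand for the same reflection; the condition
  \<open>0 \<le> i + k\<close> selects one of them.\<close>

definition ninv :: "nat \<Rightarrow> (int \<Rightarrow> int) \<Rightarrow> nat"
  where "ninv n \<pi> = card {(i, k) \<in> invs n \<pi>. 0 \<le> i + k}"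

lemma finite_invs: "finite (invs n \<pi>)"
  by (rule finite_subset[of _ "pm n \<times> pm n"]) (auto simp: invs_def finite_pm)

lemma finite_hinvs: "finite {(i, k) \<in> invs n \<pi>. 0 \<le> i + k}"
  by (rule finite_subset[OF _ finite_invs]) auto

lemma invs_uminus: "\<pi> \<in> hyperoctahedral n \<Longrightarrow> (- k, - i) \<in> invs n \<pi> \<longleftrightarrow> (i, k) \<in> invs n \<pi>"
  by (auto simp: invs_def hyperoctahedral_uminus)

lemma invs_iff_not_less:
  assumes "\<pi> \<in> hyperoctahedral n" "i \<in> pm n" "k \<in> pm n" "i < k"
  shows "(i, k) \<in> invs n \<pi> \<longleftrightarrow> \<not> \<pi> i < \<pi> k"
proof -
  have "\<pi> i \<noteq> \<pi> k"
    using assms by (simp add: hyperoctahedral_eq_iff)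
  then show ?thesis
    using assms by (auto simp: invs_def)
qed

lemma invs_id: "invs n id = {}"
  by (auto simp: invs_def)

text \<open>Only the positions that hold the exchanged values compare differently afterwards. Their
  pair and its mirror image stand for one reflection, whence the increase by exactly one.\<close>

lemma invs_adj_swap_ascent:
  assumes \<pi>: "\<pi> \<in> hyperoctahedral n" and a: "a \<in> pm n" and b: "b \<in> pm n" and ab: "a < b"
    and succ: "\<pi> b = succ_pm (\<pi> a)"
  shows "adj_swap (\<pi> a) \<circ> \<pi> \<in> hyperoctahedral n"
    and "invs n (adj_swap (\<pi> a) \<circ> \<pi>) = invs n \<pi> \<union> {(a, b), (- b, - a)}"
    and "(a, b) \<notin> invs n \<pi>"
    and "ninv n (adj_swap (\<pi> a) \<circ> \<pi>) = Suc (ninv n \<pi>)"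
proof -
  let ?x = "\<pi> a" and ?s = "adj_swap (\<pi> a)"
  have xpm: "?x \<in> pm n" "succ_pm ?x \<in> pm n"
    using \<pi> a b succ by (metis hyperoctahedral_mem_pm)+
  then have x0: "?x \<noteq> 0"
    by (simp add: mem_pm)
  show s\<pi>: "?s \<circ> \<pi> \<in> hyperoctahedral n"
    by (intro comp_hyperoctahedral adj_swap_hyperoctahedral xpm \<pi>)
  show notin: "(a, b) \<notin> invs n \<pi>"
    using succ less_succ_pm[of ?x] by (auto simp: invs_def)
  have mem: "(i, k) \<in> invs n (?s \<circ> \<pi>) \<longleftrightarrow> (i, k) \<in> invs n \<pi> \<union> {(a, b), (- b, - a)}" for i k
  proof (cases "i \<in> pm n \<and> k \<in> pm n \<and> i < k")
    case True
    have nz: "\<pi> i \<noteq> 0" "\<pi> k \<noteq> 0"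
      using True \<pi> by (metis hyperoctahedral_mem_pm mem_pm)+
    have inj: "\<pi> u = \<pi> v \<longleftrightarrow> u = v" for u v
      by (rule hyperoctahedral_eq_iff[OF \<pi>])
    have odd: "- \<pi> u = \<pi> (- u)" for u
      by (simp add: hyperoctahedral_uminus[OF \<pi>])
    have ne: "\<pi> i \<noteq> \<pi> k"
      using True inj by auto
    consider "(i, k) = (a, b)" | "(i, k) = (- b, - a)" | "(i, k) \<noteq> (a, b)" "(i, k) \<noteq> (- b, - a)"
      by blast
    then show ?thesis
    proof cases
      case 1
      then show ?thesis
        using a b ab succ less_succ_pm[of ?x] x0 by (auto simp: invs_def adj_swap_def)
    next
      case 2
      then show ?thesis
        using a b ab succ less_succ_pm[of ?x] x0 invs_uminus[OF s\<pi>, of b a]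
        by (auto simp: invs_def adj_swap_def)
    next
      case 3
      have "\<pi> k < \<pi> i \<longleftrightarrow> ?s (\<pi> k) < ?s (\<pi> i)"
      proof (cases "\<pi> k < \<pi> i")
        case lt: True
        have "(\<pi> k, \<pi> i) \<noteq> (?x, succ_pm ?x)"
          using True ab unfolding succ[symmetric] by (auto simp: inj)
        moreover have "(\<pi> k, \<pi> i) \<noteq> (- succ_pm ?x, - ?x)"
          using True ab unfolding succ[symmetric] by (auto simp: inj odd)
        ultimately show ?thesis
          using adj_swap_less[OF x0 nz(2,1) lt] lt by simp
      next
        case False
        then have lt: "\<pi> i < \<pi> k"
          using ne by simp
        have "(\<pi> i, \<pi> k) \<noteq> (?x, succ_pm ?x)"
          using 3 unfolding succ[symmetric] by (auto simp: inj)
        moreover have "(\<pi> i, \<pi> k) \<noteq> (- succ_pm ?x, - ?x)"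
          using 3 unfolding succ[symmetric] by (auto simp: inj odd)
        ultimately show ?thesis
          using adj_swap_less[OF x0 nz lt] lt by simp
      qed
      then show ?thesis
        using 3 by (auto simp: invs_def)
    qed
  next
    case False
    then show ?thesis
      using a b ab by (auto simp: invs_def)
  qed
  then show eq: "invs n (?s \<circ> \<pi>) = invs n \<pi> \<union> {(a, b), (- b, - a)}"
    by auto
  \<comment> \<open>The representative of the new reflection that \<open>ninv\<close> counts; for
    \<open>a + b = 0\<close> the two pairs coincide.\<close>
  let ?c = "if 0 \<le> a + b then (a, b) else (- b, - a)"
  have "{(i, k) \<in> invs n (?s \<circ> \<pi>). 0 \<le> i + k} = insert ?c {(i, k) \<in> invs n \<pi>. 0 \<le> i + k}"
    unfolding eq by auto
  moreover have c: "?c \<notin> {(i, k) \<in> invs n \<pi>. 0 \<le> i + k}"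
    using notin invs_uminus[OF \<pi>, of b a] by auto
  ultimately show "ninv n (?s \<circ> \<pi>) = Suc (ninv n \<pi>)"
    unfolding ninv_def using card_insert_disjoint[OF finite_hinvs c] by (simp only:)
qed

lemma invs_adj_swap_descent:
  assumes \<pi>: "\<pi> \<in> hyperoctahedral n" and a: "a \<in> pm n" and b: "b \<in> pm n" and ab: "a < b"
    and succ: "\<pi> a = succ_pm (\<pi> b)"
  shows "adj_swap (\<pi> b) \<circ> \<pi> \<in> hyperoctahedral n"
    and "invs n (adj_swap (\<pi> b) \<circ> \<pi>) = invs n \<pi> - {(a, b), (- b, - a)}"
    and "(a, b) \<in> invs n \<pi>"
    and "Suc (ninv n (adj_swap (\<pi> b) \<circ> \<pi>)) = ninv n \<pi>"
    and "(adj_swap (\<pi> b) \<circ> \<pi>) b = succ_pm ((adj_swap (\<pi> b) \<circ> \<pi>) a)"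
proof -
  let ?x = "\<pi> b" and ?s = "adj_swap (\<pi> b)"
  let ?y = "?s \<circ> \<pi>"
  have xpm: "?x \<in> pm n" "succ_pm ?x \<in> pm n"
    using \<pi> a b succ by (metis hyperoctahedral_mem_pm)+
  then have x0: "?x \<noteq> 0"
    by (simp add: mem_pm)
  show y: "?y \<in> hyperoctahedral n"
    by (intro comp_hyperoctahedral adj_swap_hyperoctahedral xpm \<pi>)
  show inab: "(a, b) \<in> invs n \<pi>"
    using a b ab succ less_succ_pm[of ?x] by (auto simp: invs_def)
  have ya: "?y a = ?x" "?y b = succ_pm ?x"
    using succ less_succ_pm[of ?x] by (auto simp: adj_swap_def)
  then show "?y b = succ_pm (?y a)"
    by simp
  \<comment> \<open>The swap is an involution, so it leads from \<open>?y\<close> back up to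
    \<open>\<pi>\<close>, and the facts about ascents are read backwards.\<close>
  have restore: "adj_swap (?y a) \<circ> ?y = \<pi>"
    using ya(1) adj_swap_involutive[OF x0] by (auto simp: fun_eq_iff)
  note asc = invs_adj_swap_ascent[OF y a b ab \<open>?y b = succ_pm (?y a)\<close>, unfolded restore]
  have "(- b, - a) \<notin> invs n ?y"
    using asc(3) invs_uminus[OF y, of b a] by blast
  then show "invs n ?y = invs n \<pi> - {(a, b), (- b, - a)}"
    using asc(2,3) by blast
  show "Suc (ninv n ?y) = ninv n \<pi>"
    using asc(4) by (rule sym)
qed

section \<open>Length and weak order\<close>

definition word_prod :: "(int \<Rightarrow> int) list \<Rightarrow> int \<Rightarrow> int"
  where "word_prod ws = foldr (\<circ>) ws id"

lemma word_prod_Nil [simp]: "word_prod [] = id"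
  and word_prod_Cons [simp]: "word_prod (s # ws) = s \<circ> word_prod ws"
  by (simp_all add: word_prod_def)

lemma word_prod_append: "word_prod (vs @ ws) = word_prod vs \<circ> word_prod ws"
  by (induction vs) (simp_all add: comp_assoc)

lemma simple_gens_hyperoctahedral: "s \<in> simple_gens n \<Longrightarrow> s \<in> hyperoctahedral n"
  by (auto simp: simple_gens_eq adj_swap_hyperoctahedral)

lemma simple_gens_involution: "s \<in> simple_gens n \<Longrightarrow> s \<circ> s = id"
  by (auto simp: simple_gens_eq mem_pm adj_swap_comp_self)

lemma word_prod_hyperoctahedral: "set ws \<subseteq> simple_gens n \<Longrightarrow> word_prod ws \<in> hyperoctahedral n"
  by (induction ws) (auto simp: id_hyperoctahedral comp_hyperoctahedral simple_gens_hyperoctahedral)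

lemma simple_gen_mult_cases:
  assumes \<pi>: "\<pi> \<in> hyperoctahedral n" and s: "s \<in> simple_gens n"
  shows "ninv n (s \<circ> \<pi>) = Suc (ninv n \<pi>) \<and> invs n \<pi> \<subseteq> invs n (s \<circ> \<pi>) \<or>
    Suc (ninv n (s \<circ> \<pi>)) = ninv n \<pi>"
proof -
  obtain x where x: "x \<in> pm n" "succ_pm x \<in> pm n" "s = adj_swap x"
    using s by (auto simp: simple_gens_eq)
  obtain a where a: "a \<in> pm n" "\<pi> a = x"
    using hyperoctahedral_surj[OF \<pi> x(1)] .
  obtain b where b: "b \<in> pm n" "\<pi> b = succ_pm x"
    using hyperoctahedral_surj[OF \<pi> x(2)] .
  have "a \<noteq> b"
    using a b less_succ_pm[of x] by auto
  then consider "a < b" | "b < a"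
    by linarith
  then show ?thesis
  proof cases
    case 1
    then show ?thesis
      using invs_adj_swap_ascent[OF \<pi> a(1) b(1)] a b x by auto
  next
    case 2
    then show ?thesis
      using invs_adj_swap_descent[OF \<pi> b(1) a(1)] a b x by auto
  qed
qed

text \<open>A letter raises \<open>ninv\<close> by at most one, and a letter that raises it keeps
  all inversions. This bounds the length of words from below and shows that a word attaining the
  bound only adds inversions.\<close>

lemma ninv_word_prod:
  assumes u: "u \<in> hyperoctahedral n" and "set ws \<subseteq> simple_gens n"
  shows "ninv n (word_prod ws \<circ> u) \<le> ninv n u + length ws \<and>
    (ninv n (word_prod ws \<circ> u) = ninv n u + length ws \<longrightarrow> invs n u \<subseteq> invs n (word_prod ws \<circ> u))"
  using assms(2)
proof (induction ws)
  case Nil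
  then show ?case by simp
next
  case (Cons s ws)
  define w w' where "w = word_prod ws \<circ> u" and "w' = s \<circ> w"
  have "w \<in> hyperoctahedral n"
    unfolding w_def using Cons.prems u by (simp add: comp_hyperoctahedral word_prod_hyperoctahedral)
  from simple_gen_mult_cases[OF this, of s] Cons.prems
  have "ninv n w' = Suc (ninv n w) \<and> invs n w \<subseteq> invs n w' \<or> Suc (ninv n w') = ninv n w"
    by (simp add: w'_def)
  moreover have "ninv n w \<le> ninv n u + length ws \<and>
    (ninv n w = ninv n u + length ws \<longrightarrow> invs n u \<subseteq> invs n w)"
    unfolding w_def by (rule Cons.IH) (use Cons.prems in simp)
  ultimately have main: "ninv n w' \<le> ninv n u + length (s # ws) \<and>
    (ninv n w' = ninv n u + length (s # ws) \<longrightarrow> invs n u \<subseteq> invs n w')"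
    by auto
  have w'_eq: "w' = word_prod (s # ws) \<circ> u"
    by (simp add: comp_assoc w_def w'_def)
  show ?case
    using main unfolding w'_eq .
qed

lemma card_pm_less_value:
  assumes "\<pi> \<in> hyperoctahedral n"
  shows "card {x \<in> pm n. x < \<pi> a} = card {b \<in> pm n. \<pi> b < \<pi> a}"
proof -
  have "bij_betw \<pi> {b \<in> pm n. \<pi> b < \<pi> a} {x \<in> pm n. x < \<pi> a}"
    unfolding bij_betw_def
  proof (intro conjI equalityI subsetI)
    show "inj_on \<pi> {b \<in> pm n. \<pi> b < \<pi> a}"
      using assms by (intro inj_onI) (simp add: hyperoctahedral_eq_iff)
    fix x assume "x \<in> {x \<in> pm n. x < \<pi> a}"
    moreover from this obtain b where "b \<in> pm n" "\<pi> b = x"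
      using hyperoctahedral_surj[OF assms] by blast
    ultimately show "x \<in> \<pi> ` {b \<in> pm n. \<pi> b < \<pi> a}"
      by blast
  qed (use assms in \<open>auto simp: hyperoctahedral_mem_pm\<close>)
  then show ?thesis
    by (rule bij_betw_same_card[symmetric])
qed

text \<open>A value is determined by its rank among all values, and both permutations take exactly
  the values in \<open>pm n\<close>.\<close>

lemma hyperoctahedral_eqI:
  assumes u: "u \<in> hyperoctahedral n" and v: "v \<in> hyperoctahedral n"
    and uv: "\<And>a b. a \<in> pm n \<Longrightarrow> b \<in> pm n \<Longrightarrow> v a < v b \<longleftrightarrow> u a < u b"
  shows "u = v"
proof
  fix a
  show "u a = v a"
  proof (cases "a \<in> pm n")
    case True
    have "{b \<in> pm n. u b < u a} = {b \<in> pm n. v b < v a}"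
      using uv True by auto
    then have card_eq: "card {x \<in> pm n. x < u a} = card {x \<in> pm n. x < v a}"
      using card_pm_less_value[OF u] card_pm_less_value[OF v] by simp
    have less: "card {x \<in> pm n. x < c} < card {x \<in> pm n. x < d}" if "c < d" "c \<in> pm n" for c d
      using that by (intro psubset_card_mono) (auto simp: finite_pm)
    have "u a \<in> pm n" "v a \<in> pm n"
      using True u v by (simp_all add: hyperoctahedral_mem_pm)
    then show ?thesis
      using card_eq less[of "u a" "v a"] less[of "v a" "u a"] by (cases "u a" "v a" rule: linorder_cases) auto
  next
    case False
    then show ?thesis
      using u v hyperoctahedral_permutes permutes_not_in by metis
  qed
qed

text \<open>While \<open>u\<close> differs from \<open>v\<close>, some two adjacent values of
  \<open>u\<close> are in the wrong order for \<open>v\<close>. Exchanging them adds an inversion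
  that \<open>v\<close> has, so the number of missing inversions drops and the path to
  \<open>v\<close> only climbs.\<close>

lemma invs_subset_word:
  assumes "u \<in> hyperoctahedral n" "v \<in> hyperoctahedral n" "invs n u \<subseteq> invs n v"
  shows "\<exists>ws. set ws \<subseteq> simple_gens n \<and> v = word_prod ws \<circ> u \<and> ninv n u + length ws = ninv n v"
  using assms
proof (induction "card (invs n v - invs n u)" arbitrary: u rule: less_induct)
  case less
  note u = less.prems(1) and v = less.prems(2)
  \<comment> \<open>Were the two positions in the opposite order, \<open>(k, i)\<close> would be an
    inversion of \<open>u\<close> that \<open>v\<close> lacks.\<close>
  have conv: "(i, k) \<in> invs n v - invs n u" if ik: "i \<in> pm n" "k \<in> pm n" "u i < u k" "v k < v i" for i k
  proof -
    have "\<not> k < i"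
    proof
      assume "k < i"
      then have "(k, i) \<in> invs n u" "(k, i) \<notin> invs n v"
        using ik by (auto simp: invs_def)
      then show False
        using less.prems by blast
    qed
    then have "i < k"
      using ik by (cases "i = k") auto
    then show ?thesis
      using ik by (auto simp: invs_def)
  qed
  show ?case
  proof (cases "u = v")
    case True
    then show ?thesis
      by (intro exI[of _ "[]"]) auto
  next
    case False
    have u_inv: "inv u (u a) = a" "u (inv u a) = a" for a
      using u hyperoctahedral_permutes permutes_inverses by metis+
    have inv_pm: "inv u a \<in> pm n \<longleftrightarrow> a \<in> pm n" for a
      using u by (simp add: hyperoctahedral_mem_pm inv_hyperoctahedral)
    \<comment> \<open>Otherwise \<open>v \<circ> inv u\<close> increases at each step between
      adjacent values, hence on all of \<open>pm n\<close>, which forces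
      \<open>u = v\<close>.\<close>
    have "\<exists>x. x \<in> pm n \<and> succ_pm x \<in> pm n \<and> v (inv u (succ_pm x)) < v (inv u x)"
    proof (rule ccontr)
      assume "\<not> ?thesis"
      then have mono: "v (inv u x) \<le> v (inv u (succ_pm x))" if "x \<in> pm n" "succ_pm x \<in> pm n" for x
        using that by force
      have mono': "v (inv u x) \<le> v (inv u y)" if xy: "x \<in> pm n" "y \<in> pm n" "x < y" for x y
      proof (rule ccontr)
        assume "\<not> ?thesis"
        then obtain w where "w \<in> pm n" "succ_pm w \<in> pm n" "v (inv u x) \<le> v (inv u w)"
          "\<not> v (inv u x) \<le> v (inv u (succ_pm w))"
          using pm_walk[OF xy, of "\<lambda>w. v (inv u x) \<le> v (inv u w)"] by auto
        then show False
          using mono[of w] by linarith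
      qed
      have "v a \<le> v b" if "a \<in> pm n" "b \<in> pm n" "u a < u b" for a b
        using mono'[of "u a" "u b"] that u by (simp add: u_inv hyperoctahedral_mem_pm)
      moreover have "u a \<noteq> u b" "v a \<noteq> v b" if "a \<noteq> b" for a b
        using that u v by (auto simp: hyperoctahedral_eq_iff)
      ultimately have uv: "v a < v b \<longleftrightarrow> u a < u b" if "a \<in> pm n" "b \<in> pm n" for a b
        using that by (metis linorder_neqE_linordered_idom order_le_less not_less_iff_gr_or_eq)
      have "u = v"
        using hyperoctahedral_eqI[OF u v] uv by blast
      then show False
        using False by simp
    qed
    then obtain x where x: "x \<in> pm n" "succ_pm x \<in> pm n" "v (inv u (succ_pm x)) < v (inv u x)"
      by blast
    let ?a = "inv u x" and ?b = "inv u (succ_pm x)"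
    have ab: "?a \<in> pm n" "?b \<in> pm n" "u ?b = succ_pm (u ?a)" "u ?a = x"
      using x by (auto simp: inv_pm u_inv)
    have new: "(?a, ?b) \<in> invs n v - invs n u"
      using conv[of ?a ?b] ab x less_succ_pm[of x] by simp
    then have "?a < ?b"
      by (auto simp: invs_def)
    note asc = invs_adj_swap_ascent[OF u ab(1,2) this ab(3), unfolded ab(4)]
    let ?u = "adj_swap x \<circ> u"
    have sub: "invs n ?u \<subseteq> invs n v"
      using asc(2) new less.prems(3) invs_uminus[OF v, of ?b ?a] by auto
    have "card (invs n v - invs n ?u) < card (invs n v - invs n u)"
      using asc(2) new by (intro psubset_card_mono) (auto simp: finite_invs)
    from less.hyps[OF this asc(1) v sub] obtain ws where ws: "set ws \<subseteq> simple_gens n"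
      "v = word_prod ws \<circ> ?u" "ninv n ?u + length ws = ninv n v"
      by blast
    have "v = word_prod (ws @ [adj_swap x]) \<circ> u"
      using ws(2) unfolding word_prod_append by (simp add: comp_assoc)
    moreover have "adj_swap x \<in> simple_gens n"
      using x by (auto simp: simple_gens_eq)
    ultimately show ?thesis
      using ws asc(4) by (intro exI[of _ "ws @ [adj_swap x]"]) simp
  qed
qed

section \<open>Coxeter length as the number of inverted reflections\<close>

lemma ninv_id: "ninv n id = 0"
  by (simp add: ninv_def invs_id)

lemma cox_length_le: "set ws \<subseteq> simple_gens n \<Longrightarrow> cox_length n (word_prod ws) \<le> length ws"
  unfolding cox_length_def word_prod_def by (rule Least_le) auto

lemma cox_length_word:
  assumes "\<pi> \<in> hyperoctahedral n"
  obtains ws where "set ws \<subseteq> simple_gens n" "\<pi> = word_prod ws" "length ws = cox_length n \<pi>"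
proof -
  have "\<exists>k ws. length ws = k \<and> set ws \<subseteq> simple_gens n \<and> \<pi> = word_prod ws"
    using invs_subset_word[OF id_hyperoctahedral assms] by (auto simp: invs_id)
  from LeastI_ex[OF this] show ?thesis
    unfolding word_prod_def cox_length_def[symmetric] using that by (auto simp: word_prod_def)
qed

lemma cox_length_eq_ninv:
  assumes "\<pi> \<in> hyperoctahedral n"
  shows "cox_length n \<pi> = ninv n \<pi>"
proof (rule antisym)
  obtain ws where "set ws \<subseteq> simple_gens n" "\<pi> = word_prod ws" "length ws = ninv n \<pi>"
    using invs_subset_word[OF id_hyperoctahedral assms] by (auto simp: invs_id ninv_id)
  then show "cox_length n \<pi> \<le> ninv n \<pi>"
    using cox_length_le by metis
next
  obtain ws where "set ws \<subseteq> simple_gens n" "\<pi> = word_prod ws" "length ws = cox_length n \<pi>"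
    using cox_length_word[OF assms] .
  then show "ninv n \<pi> \<le> cox_length n \<pi>"
    using ninv_word_prod[OF id_hyperoctahedral, of ws n] by (simp add: ninv_id)
qed

text \<open>Generators are involutions, so the reversed word spells the inverse. Inverses enter
  because parabolic quotients multiply on the right, whereas inversions are controlled under
  multiplication on the left.\<close>

lemma cox_length_inv_le:
  assumes "\<pi> \<in> hyperoctahedral n"
  shows "cox_length n (inv \<pi>) \<le> cox_length n \<pi>"
proof -
  obtain ws where ws: "set ws \<subseteq> simple_gens n" "\<pi> = word_prod ws" "length ws = cox_length n \<pi>"
    using cox_length_word[OF assms] .
  have "word_prod (rev ws) \<circ> word_prod ws = id"
    using ws(1)
  proof (induction ws)
    case (Cons s ws)
    have "word_prod (rev (s # ws)) \<circ> word_prod (s # ws) =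
      word_prod (rev ws) \<circ> (s \<circ> s) \<circ> word_prod ws"
      by (simp add: word_prod_append comp_assoc)
    also have "s \<circ> s = id"
      using Cons.prems simple_gens_involution[of s n] by simp
    finally show ?case
      using Cons.IH Cons.prems by simp
  qed simp
  then have "inv \<pi> = word_prod (rev ws)"
    using ws(2) assms hyperoctahedral_permutes
    by (metis inv_unique_comp permutes_inv_o(1) comp_assoc comp_id id_comp)
  then show ?thesis
    using cox_length_le[of "rev ws" n] ws by simp
qed

lemma cox_length_inv:
  assumes "\<pi> \<in> hyperoctahedral n"
  shows "cox_length n (inv \<pi>) = cox_length n \<pi>"
proof (rule antisym)
  show "cox_length n \<pi> \<le> cox_length n (inv \<pi>)"
    using cox_length_inv_le[OF inv_hyperoctahedral[OF assms]]
    by (simp add: permutes_inv_inv[OF hyperoctahedral_permutes[OF assms]])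
qed (rule cox_length_inv_le[OF assms])

text \<open>A shortest word for \<open>v \<circ> inv u\<close> leads from \<open>u\<close> to
  \<open>v\<close>. Its length is at least the gain in \<open>ninv\<close>; equality means that
  every letter climbs, which is possible exactly under inclusion.\<close>

lemma weak_le_iff:
  assumes u: "u \<in> hyperoctahedral n" and v: "v \<in> hyperoctahedral n"
  shows "weak_le n u v \<longleftrightarrow> invs n u \<subseteq> invs n v"
proof
  have v_eq: "v = (v \<circ> inv u) \<circ> u"
    by (simp add: comp_assoc permutes_inv_o[OF hyperoctahedral_permutes[OF u]])
  obtain ws where ws: "set ws \<subseteq> simple_gens n" "v \<circ> inv u = word_prod ws"
    "length ws = cox_length n (v \<circ> inv u)"
    using cox_length_word[OF comp_hyperoctahedral[OF v inv_hyperoctahedral[OF u]]] .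
  have *: "ninv n v \<le> ninv n u + length ws \<and> (ninv n v = ninv n u + length ws \<longrightarrow> invs n u \<subseteq> invs n v)"
    using ninv_word_prod[OF u ws(1)] ws(2) v_eq by simp
  then show "invs n u \<subseteq> invs n v" if "weak_le n u v"
    using that ws(3) u v by (simp add: weak_le_def cox_length_eq_ninv)
  show "weak_le n u v" if sub: "invs n u \<subseteq> invs n v"
  proof -
    obtain vs where vs: "set vs \<subseteq> simple_gens n" "v = word_prod vs \<circ> u" "ninv n u + length vs = ninv n v"
      using invs_subset_word[OF u v sub] by blast
    then have "v \<circ> inv u = word_prod vs"
      by (simp add: comp_assoc permutes_inv_o[OF hyperoctahedral_permutes[OF u]])
    then have "length ws \<le> length vs"
      using cox_length_le[OF vs(1)] ws(3) by simp
    then show ?thesis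
      using * vs(3) ws(3) u v by (simp add: weak_le_def cox_length_eq_ninv)
  qed
qed

lemma invs_inject:
  assumes "u \<in> hyperoctahedral n" "v \<in> hyperoctahedral n" "invs n u = invs n v"
  shows "u = v"
proof -
  have "ninv n u = ninv n v"
    by (simp add: ninv_def assms(3))
  moreover obtain ws where "v = word_prod ws \<circ> u" "ninv n u + length ws = ninv n v"
    using invs_subset_word[OF assms(1,2)] assms(3) by blast
  ultimately show ?thesis
    by simp
qed

text \<open>Right multiplication turns into left multiplication of the inverse, for which positions
  and values trade places.\<close>

lemma cox_length_mult_adj_swap:
  assumes \<pi>: "\<pi> \<in> hyperoctahedral n" and x: "x \<in> pm n" "succ_pm x \<in> pm n"
  shows "cox_length n \<pi> < cox_length n (\<pi> \<circ> adj_swap x) \<longleftrightarrow> \<pi> x < \<pi> (succ_pm x)"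
proof -
  let ?\<sigma> = "inv \<pi>"
  have \<sigma>: "?\<sigma> \<in> hyperoctahedral n"
    by (rule inv_hyperoctahedral[OF \<pi>])
  have s: "adj_swap x \<in> hyperoctahedral n"
    by (rule adj_swap_hyperoctahedral[OF x])
  have "inv (adj_swap x) = adj_swap x"
    using x adj_swap_comp_self[of x] by (intro inv_unique_comp) (auto simp: mem_pm)
  then have "inv (\<pi> \<circ> adj_swap x) = adj_swap x \<circ> ?\<sigma>"
    using \<pi> s hyperoctahedral_permutes permutes_bij by (metis o_inv_distrib)
  then have len: "cox_length n (\<pi> \<circ> adj_swap x) = ninv n (adj_swap x \<circ> ?\<sigma>)" "cox_length n \<pi> = ninv n ?\<sigma>"
    using cox_length_inv[OF \<pi>] cox_length_inv[OF comp_hyperoctahedral[OF \<pi> s]] \<sigma> s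
    by (simp_all add: cox_length_eq_ninv comp_hyperoctahedral)
  have val: "?\<sigma> (\<pi> a) = a" for a
    using \<pi> hyperoctahedral_permutes permutes_inverses by metis
  have mem: "\<pi> x \<in> pm n" "\<pi> (succ_pm x) \<in> pm n"
    using x \<pi> by (simp_all add: hyperoctahedral_mem_pm)
  have "\<pi> x \<noteq> \<pi> (succ_pm x)"
    using less_succ_pm[of x] \<pi> by (simp add: hyperoctahedral_eq_iff)
  then consider "\<pi> x < \<pi> (succ_pm x)" | "\<pi> (succ_pm x) < \<pi> x"
    by linarith
  then show ?thesis
  proof cases
    case 1
    then show ?thesis
      using invs_adj_swap_ascent(4)[OF \<sigma> mem] len by (simp add: val)
  next
    case 2
    then show ?thesis
      using invs_adj_swap_descent(4)[OF \<sigma> mem(2,1)] len by (simp add: val)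
  qed
qed

section \<open>Realizing inversion sets\<close>

lemma card_pm: "card (pm n) = 2 * n"
proof -
  have "card (pm n) = card {- int n..int n} - 1"
    unfolding pm_def by (subst card_Diff_singleton) auto
  then show ?thesis
    by simp
qed

text \<open>Take the natural order with the pairs of \<open>I\<close> reversed. The conditions on
  \<open>I\<close> make this relation \<open>prec\<close> a linear order on positions that negation
  reverses, and \<open>\<pi>\<close> sends each position to its rank.\<close>

lemma invs_realization:
  assumes sub: "\<And>i k. (i, k) \<in> I \<Longrightarrow> i \<in> pm n \<and> k \<in> pm n \<and> i < k"
    and tr: "trans I"
    and cotr: "\<And>i j k. (i, k) \<in> I \<Longrightarrow> j \<in> pm n \<Longrightarrow> i < j \<Longrightarrow> j < k \<Longrightarrow> (i, j) \<in> I \<or> (j, k) \<in> I"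
    and symm: "\<And>i k. (i, k) \<in> I \<Longrightarrow> (- k, - i) \<in> I"
  obtains \<pi> where "\<pi> \<in> hyperoctahedral n" "invs n \<pi> = I"
proof -
  define prec where "prec a b \<longleftrightarrow> a < b \<and> (a, b) \<notin> I \<or> b < a \<and> (b, a) \<in> I" for a b
  define below where "below a = {b \<in> pm n. prec b a}" for a
  \<comment> \<open>Ranks run from 0 to \<open>2 * n - 1\<close>. The lower half becomes the
    negative values; the upper half is raised by one more to leave out 0.\<close>
  define \<pi> where "\<pi> a = (if a \<notin> pm n then a
    else if card (below a) < n then int (card (below a)) - int n
    else int (card (below a)) - int n + 1)" for a
  have total: "prec a b \<or> prec b a" if "a \<noteq> b" for a b
    using that by (auto simp: prec_def)
  have asym: "\<not> prec b a" if "prec a b" for a b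
    using that by (auto simp: prec_def)
  \<comment> \<open>A failure for distinct \<open>a\<close>, \<open>b\<close>, \<open>c\<close> is a
    cycle of comparisons. Their order as integers decides whether it contradicts transitivity or
    cotransitivity of \<open>I\<close>.\<close>
  have trans': "prec a c" if abc: "prec a b" "prec b c" "a \<in> pm n" "b \<in> pm n" "c \<in> pm n" for a b c
  proof (rule ccontr)
    assume "\<not> prec a c"
    then consider "a = c" | "a < c" "(a, c) \<in> I" | "c < a" "(c, a) \<notin> I"
      by (metis prec_def linorder_neqE)
    then show False
    proof cases
      case 1
      then show ?thesis
        using abc asym by blast
    next
      case 2
      consider "b < a" | "a < b" "b < c" | "c < b"
        using abc by (auto simp: prec_def)
      then show ?thesis
      proof cases
        case 1
        then have "(b, a) \<in> I"
          using abc by (auto simp: prec_def)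
        then have "(b, c) \<in> I"
          using 2 tr by (blast dest: transD)
        then show ?thesis
          using abc 1 2 by (auto simp: prec_def)
      next
        case 2
        then show ?thesis
          using cotr[OF \<open>(a, c) \<in> I\<close> abc(4)] abc by (auto simp: prec_def)
      next
        case 3
        then have "(c, b) \<in> I"
          using abc by (auto simp: prec_def)
        then have "(a, b) \<in> I"
          using 2 tr by (blast dest: transD)
        then show ?thesis
          using abc 2 3 by (auto simp: prec_def)
      qed
    next
      case 3
      consider "b < c" | "c < b" "b < a" | "a < b"
        using abc by (auto simp: prec_def)
      then show ?thesis
      proof cases
        case 1
        then have "(b, a) \<in> I" "(b, c) \<notin> I"
          using abc 3 by (auto simp: prec_def)
        then show ?thesis
          using cotr[of b a c] 1 3 abc by blast
      next
        case 2
        then have "(b, a) \<in> I" "(c, b) \<in> I"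
          using abc by (auto simp: prec_def)
        then show ?thesis
          using 3 tr by (blast dest: transD)
      next
        case b: 3
        then have "(a, b) \<notin> I" "(c, b) \<in> I"
          using abc 3 by (auto simp: prec_def)
        then show ?thesis
          using cotr[of c b a] b 3 abc by blast
      qed
    qed
  qed
  have fin: "finite (below a)" for a
    by (simp add: below_def finite_pm)
  have below_less: "card (below a) < card (below b)" if "prec a b" "a \<in> pm n" "b \<in> pm n" for a b
  proof (rule psubset_card_mono[OF fin])
    have "a \<in> below b" "a \<notin> below a"
      using that asym by (auto simp: below_def)
    moreover have "below a \<subseteq> below b"
      using that trans' by (auto simp: below_def)
    ultimately show "below a \<subset> below b"
      by blast
  qed
  \<comment> \<open>By stability under negation, \<open>b\<close> precedes \<open>- a\<close>
    exactly when \<open>a\<close> precedes \<open>- b\<close>. So the ranks of \<open>a\<close> and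
    \<open>- a\<close> are complementary, which makes \<open>\<pi>\<close> odd.\<close>
  have compl: "card (below a) + card (below (- a)) + 1 = 2 * n" if a: "a \<in> pm n" for a
  proof -
    have "prec b (- a) \<longleftrightarrow> prec a (- b)" for b
      using symm[of b "- a"] symm[of a "- b"] symm[of "- a" b] symm[of "- b" a]
      by (auto simp: prec_def)
    then have "b \<in> below (- a) \<longleftrightarrow> - b \<in> {b \<in> pm n. prec a b}" for b
      by (simp add: below_def)
    moreover have "b \<in> uminus ` S \<longleftrightarrow> - b \<in> S" for b :: int and S
      by (metis equation_minus_iff image_iff)
    ultimately have "below (- a) = uminus ` {b \<in> pm n. prec a b}"
      by blast
    then have "card (below (- a)) = card {b \<in> pm n. prec a b}"
      by (simp add: card_image)
    moreover have "pm n = insert a (below a \<union> {b \<in> pm n. prec a b})"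
      using a total by (auto simp: below_def)
    moreover have "card (insert a (below a \<union> {b \<in> pm n. prec a b}))
        = Suc (card (below a) + card {b \<in> pm n. prec a b})"
    proof (subst card_insert_disjoint)
      show "finite (below a \<union> {b \<in> pm n. prec a b})"
        by (simp add: fin finite_pm)
      show "a \<notin> below a \<union> {b \<in> pm n. prec a b}"
        using asym by (auto simp: below_def)
      show "Suc (card (below a \<union> {b \<in> pm n. prec a b})) = Suc (card (below a) + card {b \<in> pm n. prec a b})"
        using asym by (subst card_Un_disjoint) (auto simp: fin finite_pm below_def)
    qed
    ultimately show ?thesis
      using card_pm[of n] by simp
  qed
  have mono: "\<pi> a < \<pi> b" if "prec a b" "a \<in> pm n" "b \<in> pm n" for a b
    using below_less[OF that] that by (auto simp: \<pi>_def)
  have inj: "inj_on \<pi> (pm n)"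
    using mono total by (intro inj_onI) (metis less_irrefl)
  have img: "\<pi> ` pm n \<subseteq> pm n"
  proof
    fix y assume "y \<in> \<pi> ` pm n"
    then obtain a where "a \<in> pm n" "y = \<pi> a"
      by blast
    then show "y \<in> pm n"
      using compl[of a] by (auto simp: \<pi>_def mem_pm)
  qed
  have "\<pi> ` pm n = pm n"
    by (rule endo_inj_surj[OF finite_pm img inj])
  then have "\<pi> permutes pm n"
    using inj by (intro bij_imp_permutes) (simp_all add: bij_betw_def \<pi>_def)
  moreover have "\<pi> (- a) = - \<pi> a" for a
    using compl[of a] by (auto simp: \<pi>_def)
  ultimately have \<pi>: "\<pi> \<in> hyperoctahedral n"
    by (simp add: hyperoctahedral_iff)
  have "(i, k) \<in> invs n \<pi> \<longleftrightarrow> (i, k) \<in> I" for i k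
  proof (cases "i \<in> pm n \<and> k \<in> pm n \<and> i < k")
    case True
    then have "\<pi> k < \<pi> i \<longleftrightarrow> prec k i"
      using mono[of k i] mono[of i k] total[of i k] by auto
    then show ?thesis
      using True by (auto simp: invs_def prec_def)
  next
    case False
    then show ?thesis
      using sub by (auto simp: invs_def)
  qed
  then have "invs n \<pi> = I"
    by auto
  then show ?thesis
    using that[OF \<pi>] by blast
qed

section \<open>Joins of inversion sets\<close>

lemma trans_invs: "trans (invs n \<pi>)"
  by (rule transI) (auto simp: invs_def)

text \<open>The union is cotransitive and stable under negation, but in general not transitive. Its
  closure keeps both properties: on an increasing path from \<open>i\<close> to \<open>k\<close>,
  either \<open>j\<close> is a vertex or some edge jumps over \<open>j\<close> and can be split
  there.\<close>

lemma invs_join: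
  assumes u: "u \<in> hyperoctahedral n" and v: "v \<in> hyperoctahedral n"
  obtains w where "w \<in> hyperoctahedral n" "invs n w = (invs n u \<union> invs n v)\<^sup>+"
proof -
  let ?T = "(invs n u \<union> invs n v)\<^sup>+"
  have sub: "i \<in> pm n \<and> k \<in> pm n \<and> i < k" if "(i, k) \<in> ?T" for i k
    using that by (induction rule: trancl_induct) (auto simp: invs_def)
  have "(i, j) \<in> ?T \<or> (j, k) \<in> ?T" if "(i, k) \<in> ?T" "j \<in> pm n" "i < j" "j < k" for i j k
    using that
  proof (induction rule: trancl_induct)
    case (base k)
    then have "(i, j) \<in> invs n u \<union> invs n v \<or> (j, k) \<in> invs n u \<union> invs n v"
      by (auto simp: invs_def)
    then show ?case
      by blast
  next
    case (step l k)
    consider "j < l" | "j = l" | "l < j"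
      by linarith
    then show ?case
    proof cases
      case 1
      then show ?thesis
        using step by (meson trancl.trancl_into_trancl)
    next
      case 2
      then show ?thesis
        using step by blast
    next
      case 3
      then have "(l, j) \<in> invs n u \<union> invs n v \<or> (j, k) \<in> invs n u \<union> invs n v"
        using step by (auto simp: invs_def)
      then show ?thesis
        using step.hyps by (meson r_into_trancl trancl.trancl_into_trancl)
    qed
  qed
  moreover have "(- k, - i) \<in> ?T" if "(i, k) \<in> ?T" for i k
    using that
  proof (induction rule: trancl_induct)
    case (base k)
    then have "(- k, - i) \<in> invs n u \<union> invs n v"
      using invs_uminus u v by blast
    then show ?case
      by blast
  next
    case (step l k)
    then have "(- k, - l) \<in> invs n u \<union> invs n v"
      using invs_uminus u v by blast
    then show ?case
      using step.IH by (rule trancl_into_trancl2)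
  qed
  ultimately show ?thesis
    using invs_realization[of ?T n] sub trans_trancl that by blast
qed

section \<open>Congruences from a pair of projections\<close>

text \<open>Joins respect the kernel because \<open>c\<close> is a closure operator, meets because \<open>d\<close> is an
  interior operator; here both operators have the same kernel.\<close>

lemma congruence_from_projections:
  fixes L :: "('a, 'm) gorder_scheme" (structure)
  assumes "lattice L" and A: "A \<subseteq> carrier L" and B: "B \<subseteq> carrier L"
    and d: "\<And>x. x \<in> carrier L \<Longrightarrow> d x \<in> A \<and> d x \<sqsubseteq> x \<and>
      (\<forall>a\<in>A. a \<sqsubseteq> x \<longrightarrow> a \<sqsubseteq> d x) \<and> (\<forall>b\<in>B. d x \<sqsubseteq> b \<longrightarrow> x \<sqsubseteq> b)"
    and c: "\<And>x. x \<in> carrier L \<Longrightarrow> c x \<in> B \<and> x \<sqsubseteq> c x \<and>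
      (\<forall>b\<in>B. x \<sqsubseteq> b \<longrightarrow> c x \<sqsubseteq> b) \<and> (\<forall>a\<in>A. a \<sqsubseteq> c x \<longrightarrow> a \<sqsubseteq> x)"
  defines "\<Theta> \<equiv> {(x, y). x \<in> carrier L \<and> y \<in> carrier L \<and> d x = d y}"
  shows "lattice_congruence L \<Theta>"
    and "order_isomorphic (quotient_lattice L \<Theta>) \<lparr>carrier = A, eq = (=), le = le L\<rparr>"
proof -
  interpret lattice L by fact
  have dL: "d x \<in> carrier L" and cL: "c x \<in> carrier L" if "x \<in> carrier L" for x
    using A B c[OF that] d[OF that] by auto
  have d_mono: "d x \<sqsubseteq> d y" if "x \<in> carrier L" "y \<in> carrier L" "x \<sqsubseteq> y" for x y
    using that d[of x] d[of y] dL[of x] le_trans[of "d x" x y] by simp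
  have c_mono: "c x \<sqsubseteq> c y" if "x \<in> carrier L" "y \<in> carrier L" "x \<sqsubseteq> y" for x y
    using that c[of x] c[of y] cL[of y] le_trans[of x y "c y"] by simp
  \<comment> \<open>The element \<open>d x = d y\<close> lies below \<open>y\<close> and so below
    \<open>c y\<close>. As \<open>c y\<close> is in \<open>B\<close>, the last condition on
    \<open>d\<close> lifts this to \<open>x\<close> itself. The reverse inclusion of kernels is the
    order dual.\<close>
  have c_le: "c x \<sqsubseteq> c y" if xy: "x \<in> carrier L" "y \<in> carrier L" "d x = d y" for x y
  proof -
    have "d x \<sqsubseteq> c y"
      using xy d[of y] c[of y] dL[of y] cL[of y] le_trans[of "d y" y "c y"] by simp
    then have "x \<sqsubseteq> c y"
      using xy d[of x] c[of y] by simp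
    then show ?thesis
      using xy c[of x] c[of y] by simp
  qed
  have d_le: "d x \<sqsubseteq> d y" if xy: "x \<in> carrier L" "y \<in> carrier L" "c x = c y" for x y
  proof -
    have "d x \<sqsubseteq> c y"
      using xy d[of x] c[of x] dL[of x] cL[of x] le_trans[of "d x" x "c x"] by simp
    then have "d x \<sqsubseteq> y"
      using xy d[of x] c[of y] by simp
    then show ?thesis
      using xy d[of x] d[of y] by simp
  qed
  have ker: "d x = d y \<longleftrightarrow> c x = c y" if "x \<in> carrier L" "y \<in> carrier L" for x y
    using that c_le[of x y] c_le[of y x] d_le[of x y] d_le[of y x] dL[of x] dL[of y] cL[of x] cL[of y]
      le_antisym[of "d x" "d y"] le_antisym[of "c x" "c y"] by auto
  have join_le: "c (x' \<squnion> y') \<sqsubseteq> c (x \<squnion> y)"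
    if L: "x \<in> carrier L" "x' \<in> carrier L" "y \<in> carrier L" "y' \<in> carrier L"
      and eq: "d x = d x'" "d y = d y'" for x x' y y'
  proof -
    have "c x' \<sqsubseteq> c (x \<squnion> y)" "c y' \<sqsubseteq> c (x \<squnion> y)"
      using L eq ker[of x x'] ker[of y y'] c_mono[of x "x \<squnion> y"] c_mono[of y "x \<squnion> y"]
        join_left[of x y] join_right[of x y] by simp_all
    then have "x' \<sqsubseteq> c (x \<squnion> y)" "y' \<sqsubseteq> c (x \<squnion> y)"
      using L c[of x'] c[of y'] cL[of x'] cL[of y'] cL[of "x \<squnion> y"]
        le_trans[of x' "c x'" "c (x \<squnion> y)"] le_trans[of y' "c y'" "c (x \<squnion> y)"] by simp_all
    then have "x' \<squnion> y' \<sqsubseteq> c (x \<squnion> y)"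
      using L cL by (intro join_le) auto
    then show ?thesis
      using L c[of "x' \<squnion> y'"] c[of "x \<squnion> y"] by simp
  qed
  have meet_le: "d (x \<sqinter> y) \<sqsubseteq> d (x' \<sqinter> y')"
    if L: "x \<in> carrier L" "x' \<in> carrier L" "y \<in> carrier L" "y' \<in> carrier L"
      and eq: "d x = d x'" "d y = d y'" for x x' y y'
  proof -
    have "d (x \<sqinter> y) \<sqsubseteq> d x'" "d (x \<sqinter> y) \<sqsubseteq> d y'"
      using L eq d_mono[of "x \<sqinter> y" x] d_mono[of "x \<sqinter> y" y]
        meet_left[of x y] meet_right[of x y] by simp_all
    then have "d (x \<sqinter> y) \<sqsubseteq> x'" "d (x \<sqinter> y) \<sqsubseteq> y'"
      using L d[of x'] d[of y'] dL[of x'] dL[of y'] dL[of "x \<sqinter> y"]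
        le_trans[of "d (x \<sqinter> y)" "d x'" x'] le_trans[of "d (x \<sqinter> y)" "d y'" y'] by simp_all
    then have "d (x \<sqinter> y) \<sqsubseteq> x' \<sqinter> y'"
      using L dL by (intro meet_le) auto
    then show ?thesis
      using L d[of "x' \<sqinter> y'"] d[of "x \<sqinter> y"] by simp
  qed
  have equiv: "equiv (carrier L) \<Theta>"
    by (auto simp: \<Theta>_def equiv_def refl_on_def sym_def trans_def)
  have "(x \<squnion> y, x' \<squnion> y') \<in> \<Theta> \<and> (x \<sqinter> y, x' \<sqinter> y') \<in> \<Theta>"
    if "(x, x') \<in> \<Theta>" "(y, y') \<in> \<Theta>" for x x' y y'
  proof -
    have L: "x \<in> carrier L" "x' \<in> carrier L" "y \<in> carrier L" "y' \<in> carrier L"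
      and eq: "d x = d x'" "d y = d y'"
      using that by (auto simp: \<Theta>_def)
    have "c (x \<squnion> y) = c (x' \<squnion> y')"
      using join_le[OF L eq] join_le[OF L(2,1,4,3) eq[symmetric]] L cL
      by (simp add: le_antisym)
    moreover have "d (x \<sqinter> y) = d (x' \<sqinter> y')"
      using meet_le[OF L eq] meet_le[OF L(2,1,4,3) eq[symmetric]] L dL
      by (simp add: le_antisym)
    ultimately show ?thesis
      using L ker by (simp add: \<Theta>_def)
  qed
  with equiv show cong: "lattice_congruence L \<Theta>"
    by (simp add: lattice_congruence_def)
  have d_idem: "d a = a" if "a \<in> A" for a
  proof -
    have "a \<in> carrier L"
      using that A by blast
    then show ?thesis
      using that d[of a] dL[of a] le_antisym[of "d a" a] by simp
  qed
  \<comment> \<open>Each class contains a member of \<open>A\<close>, namely \<open>d x\<close>, and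
    only one since \<open>d\<close> fixes \<open>A\<close>; this identifies the quotient with
    \<open>A\<close>.\<close>
  have class_rep: "\<Theta> `` {x} = \<Theta> `` {d x}" "(x, d x) \<in> \<Theta>" if "x \<in> carrier L" for x
    using that d[OF that] d_idem dL by (auto simp: \<Theta>_def)
  let ?f = "\<lambda>a. \<Theta> `` {a}"
  have f_le: "?f a \<sqsubseteq>\<^bsub>quotient_lattice L \<Theta>\<^esub> ?f b \<longleftrightarrow> a \<sqsubseteq> b" if ab: "a \<in> A" "b \<in> A" for a b
  proof
    assume "?f a \<sqsubseteq>\<^bsub>quotient_lattice L \<Theta>\<^esub> ?f b"
    then obtain x y where xy: "(a, x) \<in> \<Theta>" "(b, y) \<in> \<Theta>" "x \<sqsubseteq> y"
      by (auto simp: quotient_lattice_def)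
    then have "d x \<sqsubseteq> d y"
      by (intro d_mono) (auto simp: \<Theta>_def)
    then show "a \<sqsubseteq> b"
      using xy ab d_idem by (auto simp: \<Theta>_def)
  next
    assume "a \<sqsubseteq> b"
    moreover have "(a, a) \<in> \<Theta>" "(b, b) \<in> \<Theta>"
      using ab A by (auto simp: \<Theta>_def)
    ultimately show "?f a \<sqsubseteq>\<^bsub>quotient_lattice L \<Theta>\<^esub> ?f b"
      by (auto simp: quotient_lattice_def)
  qed
  have bij: "bij_betw ?f A (carrier (quotient_lattice L \<Theta>))"
    unfolding bij_betw_def
  proof
    show "inj_on ?f A"
    proof (rule inj_onI)
      fix a b assume "a \<in> A" "b \<in> A" "?f a = ?f b"
      moreover from this have "(b, b) \<in> \<Theta>"
        using A by (auto simp: \<Theta>_def)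
      ultimately have "(a, b) \<in> \<Theta>"
        by blast
      then show "a = b"
        using \<open>a \<in> A\<close> \<open>b \<in> A\<close> d_idem by (simp add: \<Theta>_def)
    qed
    show "?f ` A = carrier (quotient_lattice L \<Theta>)"
    proof
      show "?f ` A \<subseteq> carrier (quotient_lattice L \<Theta>)"
        using A by (auto simp: quotient_lattice_def intro!: quotientI)
      show "carrier (quotient_lattice L \<Theta>) \<subseteq> ?f ` A"
      proof
        fix X assume "X \<in> carrier (quotient_lattice L \<Theta>)"
        then obtain x where "x \<in> carrier L" "X = ?f x"
          by (auto simp: quotient_lattice_def elim: quotientE)
        then show "X \<in> ?f ` A"
          using class_rep(1)[of x] d[of x] by auto
      qed
    qed
  qed
  let ?g = "the_inv_into A ?f"
  have g: "?g X \<in> A" "?f (?g X) = X" if "X \<in> carrier (quotient_lattice L \<Theta>)" for X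
    using that bij the_inv_into_into[of ?f A X A] f_the_inv_into_f[of ?f A X]
    unfolding bij_betw_def by blast+
  show "order_isomorphic (quotient_lattice L \<Theta>) \<lparr>carrier = A, eq = (=), le = le L\<rparr>"
    unfolding order_isomorphic_def
  proof (intro exI[of _ ?g] conjI ballI)
    show "bij_betw ?g (carrier (quotient_lattice L \<Theta>)) (carrier \<lparr>carrier = A, eq = (=), le = le L\<rparr>)"
      using bij_betw_the_inv_into[OF bij] by simp
    fix X Y assume XY: "X \<in> carrier (quotient_lattice L \<Theta>)" "Y \<in> carrier (quotient_lattice L \<Theta>)"
    then show "X \<sqsubseteq>\<^bsub>quotient_lattice L \<Theta>\<^esub> Y \<longleftrightarrow> ?g X \<sqsubseteq>\<^bsub>\<lparr>carrier = A, eq = (=), le = le L\<rparr>\<^esub> ?g Y"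
      using f_le[of "?g X" "?g Y"] g by simp
  qed
qed

text \<open>An order isomorphism relates carriers and orders only, so that \<open>eq M\<close> is
  equality enters as a separate premise.\<close>

lemma lattice_order_isomorphic:
  fixes L :: "('a, 'm) gorder_scheme" and M :: "('b, 'k) gorder_scheme"
  assumes "lattice L" "order_isomorphic L M" and eq: "eq M = (=)"
  shows "lattice M"
proof -
  interpret lattice L by fact
  obtain f where f: "bij_betw f (carrier L) (carrier M)"
    and f_le: "\<And>x y. x \<in> carrier L \<Longrightarrow> y \<in> carrier L \<Longrightarrow> x \<sqsubseteq>\<^bsub>L\<^esub> y \<longleftrightarrow> f x \<sqsubseteq>\<^bsub>M\<^esub> f y"
    using assms(2) unfolding order_isomorphic_def by blast
  have img: "carrier M = f ` carrier L"
    using f by (simp add: bij_betw_def)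
  interpret M: partial_order M
  proof (unfold_locales, goal_cases)
    case (5 x y)
    then obtain a b where ab: "a \<in> carrier L" "b \<in> carrier L" "x = f a" "y = f b"
      by (auto simp: img)
    then show ?case
      using 5 le_antisym[of a b] by (simp add: eq flip: f_le)
  next
    case (6 x y z)
    then show ?case
      by (auto simp: img simp flip: f_le intro: le_trans)
  qed (auto simp: eq img simp flip: f_le)
  show ?thesis
  proof (unfold_locales, goal_cases)
    case (1 x y)
    then obtain a b where ab: "a \<in> carrier L" "b \<in> carrier L" "x = f a" "y = f b"
      by (auto simp: img)
    have "is_lub M (f (a \<squnion>\<^bsub>L\<^esub> b)) {x, y}"
      using ab join_left[of a b] join_right[of a b] join_le[of a _ b]
      by (auto simp: least_def Upper_def img simp flip: f_le)
    then show ?case ..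
  next
    case (2 x y)
    then obtain a b where ab: "a \<in> carrier L" "b \<in> carrier L" "x = f a" "y = f b"
      by (auto simp: img)
    have "is_glb M (f (a \<sqinter>\<^bsub>L\<^esub> b)) {x, y}"
      using ab meet_left[of a b] meet_right[of a b] meet_le[of _ a b]
      by (auto simp: greatest_def Lower_def img simp flip: f_le)
    then show ?case ..
  qed
qed

section \<open>Contracted covers\<close>

text \<open>\<open>D i k\<close> says that a cut separates the positions \<open>i < k\<close>. The predicate \<open>E j\<close> says
  on which side a position \<open>j\<close> in the middle of a pattern obstructs: above if it holds,
  below otherwise. By the assumption on \<open>E\<close>, a pattern with middle position \<open>j\<close> is the mirror
  image of one with middle position \<open>-j\<close>.\<close>

locale pattern_data =
  fixes n :: nat and D :: "int \<Rightarrow> int \<Rightarrow> bool" and E :: "int \<Rightarrow> bool"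
  assumes D_widen: "D i k \<Longrightarrow> i' \<le> i \<Longrightarrow> k \<le> k' \<Longrightarrow> D i' k'"
    and D_uminus: "D i k \<Longrightarrow> D (- k) (- i)"
    and E_uminus: "j \<in> pm n \<Longrightarrow> E (- j) \<longleftrightarrow> \<not> E j"
begin

definition admissible :: "(int \<Rightarrow> int) set"
  where "admissible = {\<pi> \<in> hyperoctahedral n. \<forall>(i, k)\<in>invs n \<pi>. D i k}"

text \<open>For a cover at \<open>i\<close>, \<open>k\<close> this places the value at
  \<open>j\<close> above both values if \<open>E j\<close>, and below both otherwise. The pair
  \<open>(i, k)\<close> itself does not occur, so the condition reads the same at both ends of the
  cover.\<close>

definition obstructed :: "(int \<times> int) set \<Rightarrow> int \<Rightarrow> int \<Rightarrow> bool"
  where "obstructed I i k \<longleftrightarrow>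
    (\<exists>j\<in>pm n. i < j \<and> j < k \<and> D i j \<and> D j k \<and>
      (if E j then (i, j) \<notin> I \<and> (j, k) \<in> I else (i, j) \<in> I \<and> (j, k) \<notin> I))"

definition bottoms :: "(int \<Rightarrow> int) set"
  where "bottoms = {\<pi> \<in> admissible. \<forall>i\<in>pm n. \<forall>k\<in>pm n.
    i < k \<longrightarrow> \<pi> i = succ_pm (\<pi> k) \<longrightarrow> \<not> obstructed (invs n \<pi>) i k}"

definition tops :: "(int \<Rightarrow> int) set"
  where "tops = {\<pi> \<in> admissible. \<forall>i\<in>pm n. \<forall>k\<in>pm n.
    i < k \<longrightarrow> \<pi> k = succ_pm (\<pi> i) \<longrightarrow> \<not> obstructed (invs n \<pi>) i k}"

lemma admissible_hyperoctahedral: "\<pi> \<in> admissible \<Longrightarrow> \<pi> \<in> hyperoctahedral n"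
  by (simp add: admissible_def)

lemma admissible_weak_le_iff: "u \<in> admissible \<Longrightarrow> v \<in> admissible \<Longrightarrow> weak_le n u v \<longleftrightarrow> invs n u \<subseteq> invs n v"
  by (simp add: admissible_def weak_le_iff)

text \<open>Meant for the two ends of a cover, whose inversion sets differ only in
  \<open>(i, k)\<close> and \<open>(- k, - i)\<close>. The mirror pair starts at \<open>i\<close> or
  ends at \<open>k\<close> only if it equals \<open>(i, k)\<close>.\<close>

lemma obstructed_cong:
  assumes "\<And>j. j \<noteq> k \<Longrightarrow> (i, j) \<in> I \<longleftrightarrow> (i, j) \<in> J" "\<And>j. j \<noteq> i \<Longrightarrow> (j, k) \<in> I \<longleftrightarrow> (j, k) \<in> J"
  shows "obstructed I i k \<longleftrightarrow> obstructed J i k"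
proof -
  have "(i < j \<and> j < k \<and> D i j \<and> D j k \<and>
      (if E j then (i, j) \<notin> I \<and> (j, k) \<in> I else (i, j) \<in> I \<and> (j, k) \<notin> I)) \<longleftrightarrow>
    (i < j \<and> j < k \<and> D i j \<and> D j k \<and>
      (if E j then (i, j) \<notin> J \<and> (j, k) \<in> J else (i, j) \<in> J \<and> (j, k) \<notin> J))" for j
    using assms[of j] by auto
  then show ?thesis
    unfolding obstructed_def by simp
qed

text \<open>Paths of inversions increase, so a cut crossed by the first edge stays crossed. The join
  in the full weak order is therefore admissible again.\<close>

lemma ex_invs_join:
  assumes "u \<in> admissible" "v \<in> admissible"
  shows "\<exists>w\<in>admissible. invs n u \<subseteq> invs n w \<and> invs n v \<subseteq> invs n w \<and>
    (\<forall>z\<in>admissible. invs n u \<subseteq> invs n z \<longrightarrow> invs n v \<subseteq> invs n z \<longrightarrow> invs n w \<subseteq> invs n z)"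
proof -
  obtain w where w: "w \<in> hyperoctahedral n" "invs n w = (invs n u \<union> invs n v)\<^sup>+"
    using invs_join assms admissible_hyperoctahedral by metis
  have "D i k" if "(i, k) \<in> (invs n u \<union> invs n v)\<^sup>+" for i k
    using that
  proof (induction rule: trancl_induct)
    case (base k)
    then show ?case
      using assms by (auto simp: admissible_def)
  next
    case (step l k)
    then have "l \<le> k"
      by (auto simp: invs_def)
    then show ?case
      using step.IH D_widen by blast
  qed
  then have "w \<in> admissible"
    using w by (auto simp: admissible_def)
  moreover have "invs n u \<subseteq> invs n w" "invs n v \<subseteq> invs n w"
    unfolding w(2) by auto
  moreover have "invs n w \<subseteq> invs n z" if "invs n u \<subseteq> invs n z" "invs n v \<subseteq> invs n z" for z
    unfolding w(2) using that trancl_mono_subset[of "invs n u \<union> invs n v" "invs n z"]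
      trancl_id[OF trans_invs, of n z] by simp
  ultimately show ?thesis
    by (intro bexI[of _ w]) simp_all
qed

text \<open>Intersections of inversion sets can fail to be cotransitive, so the meet is found
  indirectly: among the common lower bounds, one of which is \<open>id\<close>, one with the most
  inversions absorbs every other by joining.\<close>

lemma ex_invs_meet:
  assumes u: "u \<in> admissible" and v: "v \<in> admissible"
  shows "\<exists>w\<in>admissible. invs n w \<subseteq> invs n u \<and> invs n w \<subseteq> invs n v \<and>
    (\<forall>z\<in>admissible. invs n z \<subseteq> invs n u \<longrightarrow> invs n z \<subseteq> invs n v \<longrightarrow> invs n z \<subseteq> invs n w)"
proof -
  define low where "low z \<longleftrightarrow> z \<in> admissible \<and> invs n z \<subseteq> invs n u \<and> invs n z \<subseteq> invs n v" for z
  have "low id"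
    by (auto simp: low_def admissible_def id_hyperoctahedral invs_id)
  moreover have "\<forall>z. low z \<longrightarrow> card (invs n z) < Suc (card (invs n u))"
    by (auto simp: low_def less_Suc_eq_le finite_invs intro: card_mono)
  ultimately obtain m where m: "low m" "\<And>z. low z \<Longrightarrow> card (invs n z) \<le> card (invs n m)"
    using ex_has_greatest_nat[of low id "\<lambda>z. card (invs n z)" "Suc (card (invs n u))"] by blast
  have "invs n z \<subseteq> invs n m" if z: "low z" for z
  proof -
    obtain w where w: "w \<in> admissible" "invs n m \<subseteq> invs n w" "invs n z \<subseteq> invs n w"
      "\<And>y. y \<in> admissible \<Longrightarrow> invs n m \<subseteq> invs n y \<Longrightarrow> invs n z \<subseteq> invs n y \<Longrightarrow> invs n w \<subseteq> invs n y"
      using ex_invs_join[of m z] m(1) z unfolding low_def by metis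
    have "low w"
      using m(1) z w(1) w(4)[OF u] w(4)[OF v] by (simp add: low_def)
    then have "invs n m = invs n w"
      using m(2) w(2) by (intro card_seteq) (auto simp: finite_invs)
    then show ?thesis
      using w(3) by simp
  qed
  then show ?thesis
    using m(1) unfolding low_def by blast
qed

lemma lattice_admissible: "lattice (weak_order_on n admissible)"
proof -
  interpret partial_order "weak_order_on n admissible"
  proof (unfold_locales, goal_cases)
    case (5 u v)
    then have "invs n u = invs n v"
      by (auto simp: weak_order_on_def admissible_weak_le_iff)
    then show ?case
      using 5 by (auto simp: weak_order_on_def admissible_def intro: invs_inject)
  next
    case (6 u v w)
    then show ?case
      by (auto simp: weak_order_on_def admissible_weak_le_iff)
  qed (auto simp: weak_order_on_def admissible_weak_le_iff)
  show ?thesis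
  proof (unfold_locales, goal_cases)
    case (1 u v)
    then have uv: "u \<in> admissible" "v \<in> admissible"
      by (auto simp: weak_order_on_def)
    then obtain w where w: "w \<in> admissible" "invs n u \<subseteq> invs n w" "invs n v \<subseteq> invs n w"
      "\<And>z. z \<in> admissible \<Longrightarrow> invs n u \<subseteq> invs n z \<Longrightarrow> invs n v \<subseteq> invs n z \<Longrightarrow> invs n w \<subseteq> invs n z"
      using ex_invs_join[OF uv] by blast
    have "is_lub (weak_order_on n admissible) w {u, v}"
      unfolding least_def
    proof (intro conjI ballI)
      show "Upper (weak_order_on n admissible) {u, v} \<subseteq> carrier (weak_order_on n admissible)"
        by (rule Upper_closed)
      show "w \<in> Upper (weak_order_on n admissible) {u, v}"
        using w uv by (simp add: Upper_def weak_order_on_def admissible_weak_le_iff)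
      fix z assume z: "z \<in> Upper (weak_order_on n admissible) {u, v}"
      then have "z \<in> admissible" "weak_le n u z" "weak_le n v z"
        using uv unfolding Upper_def weak_order_on_def by simp_all
      then show "w \<sqsubseteq>\<^bsub>weak_order_on n admissible\<^esub> z"
        using w(1) w(4)[of z] uv by (simp add: weak_order_on_def admissible_weak_le_iff)
    qed
    then show ?case
      by (rule exI[of _ w])
  next
    case (2 u v)
    then have uv: "u \<in> admissible" "v \<in> admissible"
      by (auto simp: weak_order_on_def)
    then obtain w where w: "w \<in> admissible" "invs n w \<subseteq> invs n u" "invs n w \<subseteq> invs n v"
      "\<And>z. z \<in> admissible \<Longrightarrow> invs n z \<subseteq> invs n u \<Longrightarrow> invs n z \<subseteq> invs n v \<Longrightarrow> invs n z \<subseteq> invs n w"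
      using ex_invs_meet[OF uv] by blast
    have "is_glb (weak_order_on n admissible) w {u, v}"
      unfolding greatest_def
    proof (intro conjI ballI)
      show "Lower (weak_order_on n admissible) {u, v} \<subseteq> carrier (weak_order_on n admissible)"
        by (rule Lower_closed)
      show "w \<in> Lower (weak_order_on n admissible) {u, v}"
        using w uv by (simp add: Lower_def weak_order_on_def admissible_weak_le_iff)
      fix z assume z: "z \<in> Lower (weak_order_on n admissible) {u, v}"
      then have "z \<in> admissible" "weak_le n z u" "weak_le n z v"
        using uv unfolding Lower_def weak_order_on_def by simp_all
      then show "z \<sqsubseteq>\<^bsub>weak_order_on n admissible\<^esub> w"
        using w(1) w(4)[of z] uv by (simp add: weak_order_on_def admissible_weak_le_iff)
    qed
    then show ?case
      by (rule exI[of _ w])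
  qed
qed

text \<open>Positions whose \<open>a\<close>-value lies strictly between \<open>a k\<close> and \<open>a i\<close> must lie outside of
  \<open>[i, k]\<close>, since \<open>x\<close> has no value to give them. Going through the values from \<open>a k\<close> up to
  \<open>a i\<close> therefore jumps across \<open>[i, k]\<close> at an adjacent descent, which \<open>j\<close> obstructs.\<close>

lemma bottoms_skip_obstructed_descent:
  assumes x: "x \<in> hyperoctahedral n" and i: "i \<in> pm n" and k: "k \<in> pm n" and ik: "i < k"
    and succ: "x i = succ_pm (x k)" and obs: "obstructed (invs n x) i k"
    and a: "a \<in> bottoms" and sub: "invs n a \<subseteq> invs n x"
  shows "(i, k) \<notin> invs n a"
proof
  assume inv_ik: "(i, k) \<in> invs n a"
  have aH: "a \<in> hyperoctahedral n"
    using a by (simp add: bottoms_def admissible_def)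
  have outside: "\<not> (i < p \<and> p < k)" if p: "p \<in> pm n" "a k < a p" "a p < a i" for p
  proof
    assume "i < p \<and> p < k"
    then have "(i, p) \<in> invs n a" "(p, k) \<in> invs n a"
      using p i k by (auto simp: invs_def)
    then have "x k < x p" "x p < x i"
      using sub by (auto simp: invs_def)
    moreover have "x p \<noteq> 0"
      using x p by (metis hyperoctahedral_mem_pm mem_pm)
    ultimately show False
      using succ succ_pm_le[of "x k" "x p"] by simp
  qed
  have "a k < a i"
    using inv_ik by (auto simp: invs_def)
  moreover have inv_a: "inv a (a p) = p" "a (inv a p) = p" for p
    using aH hyperoctahedral_permutes permutes_inverses by metis+
  moreover have "a i \<in> pm n" "a k \<in> pm n"
    using aH i k by (simp_all add: hyperoctahedral_mem_pm)
  ultimately obtain w where w: "w \<in> pm n" "succ_pm w \<in> pm n" "a k \<le> w" "succ_pm w \<le> a i"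
    "k \<le> inv a w" "\<not> k \<le> inv a (succ_pm w)"
    using pm_walk[of "a k" n "a i" "\<lambda>w. k \<le> inv a w"] ik by auto
  obtain p q where pq: "p \<in> pm n" "q \<in> pm n" "a q = w" "a p = succ_pm w" "k \<le> q" "\<not> k \<le> p"
    using w inv_a aH by (metis hyperoctahedral_mem_pm inv_hyperoctahedral)
  have "p \<le> i"
  proof (rule ccontr)
    assume "\<not> p \<le> i"
    then have "a p \<noteq> a i"
      using aH by (auto simp: hyperoctahedral_eq_iff)
    then show False
      using outside[of p] \<open>\<not> p \<le> i\<close> pq w less_succ_pm[of w] by auto
  qed
  obtain j where j: "j \<in> pm n" "i < j" "j < k" "D i j" "D j k"
    "if E j then (i, j) \<notin> invs n x \<and> (j, k) \<in> invs n x else (i, j) \<in> invs n x \<and> (j, k) \<notin> invs n x"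
    using obs by (auto simp: obstructed_def)
  have D: "D p j" "D j q"
    using j pq \<open>p \<le> i\<close> D_widen by (meson order_refl)+
  have lt: "p < j" "j < q"
    using j pq \<open>p \<le> i\<close> by auto
  \<comment> \<open>Only the non-inversion in the obstruction passes from \<open>x\<close> down to
    \<open>a\<close>. It suffices: it puts \<open>a j\<close> above \<open>a i\<close> or below
    \<open>a k\<close>, hence beyond \<open>w\<close> and \<open>succ_pm w\<close>, which lie
    between those two.\<close>
  have "if E j then (p, j) \<notin> invs n a \<and> (j, q) \<in> invs n a else (p, j) \<in> invs n a \<and> (j, q) \<notin> invs n a"
  proof (cases "E j")
    case True
    then have "(i, j) \<notin> invs n a"
      using j sub by auto
    then have "a i < a j"
      using invs_iff_not_less[OF aH i j(1,2)] by simp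
    then show ?thesis
      using True pq w j lt less_succ_pm[of w] by (auto simp: invs_def)
  next
    case False
    then have "(j, k) \<notin> invs n a"
      using j sub by auto
    then have "a j < a k"
      using invs_iff_not_less[OF aH j(1) k j(3)] by simp
    then show ?thesis
      using False pq w j lt less_succ_pm[of w] by (auto simp: invs_def)
  qed
  then have "obstructed (invs n a) p q"
    using j(1) D lt unfolding obstructed_def by blast
  moreover have "p < q" "a p = succ_pm (a q)"
    using lt pq by auto
  ultimately show False
    using a pq unfolding bottoms_def by blast
qed

text \<open>Dual to the previous argument: the walk through the values from \<open>b i\<close> to
  \<open>b k\<close> jumps across \<open>[i, k]\<close> at an adjacent ascent. Now it is the
  inversion in the obstruction that passes from \<open>y\<close> up to \<open>b\<close>.\<close>

lemma tops_contain_obstructed_ascent: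
  assumes y: "y \<in> hyperoctahedral n" and i: "i \<in> pm n" and k: "k \<in> pm n" and ik: "i < k"
    and succ: "y k = succ_pm (y i)" and obs: "obstructed (invs n y) i k"
    and b: "b \<in> tops" and sub: "invs n y \<subseteq> invs n b"
  shows "(i, k) \<in> invs n b"
proof (rule ccontr)
  assume inv_ik: "(i, k) \<notin> invs n b"
  have bH: "b \<in> hyperoctahedral n"
    using b by (simp add: tops_def admissible_def)
  have outside: "\<not> (i < p \<and> p < k)" if p: "p \<in> pm n" "b i < b p" "b p < b k" for p
  proof
    assume ipk: "i < p \<and> p < k"
    then have "(i, p) \<notin> invs n b" "(p, k) \<notin> invs n b"
      using p i k by (auto simp: invs_def)
    then have "(i, p) \<notin> invs n y" "(p, k) \<notin> invs n y"
      using sub by auto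
    then have "y i < y p" "y p < y k"
      using invs_iff_not_less[OF y] ipk i k p by auto
    moreover have "y p \<noteq> 0"
      using y p by (metis hyperoctahedral_mem_pm mem_pm)
    ultimately show False
      using succ succ_pm_le[of "y i" "y p"] by simp
  qed
  have "b i < b k"
    using inv_ik invs_iff_not_less[OF bH i k ik] by simp
  moreover have inv_b: "inv b (b p) = p" "b (inv b p) = p" for p
    using bH hyperoctahedral_permutes permutes_inverses by metis+
  moreover have "b i \<in> pm n" "b k \<in> pm n"
    using bH i k by (simp_all add: hyperoctahedral_mem_pm)
  ultimately obtain w where w: "w \<in> pm n" "succ_pm w \<in> pm n" "b i \<le> w" "succ_pm w \<le> b k"
    "inv b w \<le> i" "\<not> inv b (succ_pm w) \<le> i"
    using pm_walk[of "b i" n "b k" "\<lambda>w. inv b w \<le> i"] ik by auto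
  obtain p q where pq: "p \<in> pm n" "q \<in> pm n" "b p = w" "b q = succ_pm w" "p \<le> i" "\<not> q \<le> i"
    using w inv_b bH by (metis hyperoctahedral_mem_pm inv_hyperoctahedral)
  have "k \<le> q"
  proof (rule ccontr)
    assume "\<not> k \<le> q"
    then have "b q \<noteq> b k"
      using bH by (auto simp: hyperoctahedral_eq_iff)
    then show False
      using outside[of q] \<open>\<not> k \<le> q\<close> pq w less_succ_pm[of w] by auto
  qed
  obtain j where j: "j \<in> pm n" "i < j" "j < k" "D i j" "D j k"
    "if E j then (i, j) \<notin> invs n y \<and> (j, k) \<in> invs n y else (i, j) \<in> invs n y \<and> (j, k) \<notin> invs n y"
    using obs by (auto simp: obstructed_def)
  have D: "D p j" "D j q"
    using j pq \<open>k \<le> q\<close> D_widen by (meson order_refl)+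
  have lt: "p < j" "j < q"
    using j pq \<open>k \<le> q\<close> by auto
  have "if E j then (p, j) \<notin> invs n b \<and> (j, q) \<in> invs n b else (p, j) \<in> invs n b \<and> (j, q) \<notin> invs n b"
  proof (cases "E j")
    case True
    then have "(j, k) \<in> invs n b"
      using j sub by auto
    then have "b k < b j"
      by (simp add: invs_def)
    then show ?thesis
      using True pq w j lt less_succ_pm[of w] by (auto simp: invs_def)
  next
    case False
    then have "(i, j) \<in> invs n b"
      using j sub by auto
    then have "b j < b i"
      by (simp add: invs_def)
    then show ?thesis
      using False pq w j lt less_succ_pm[of w] by (auto simp: invs_def)
  qed
  then have "obstructed (invs n b) p q"
    using j(1) D lt unfolding obstructed_def by blast
  moreover have "p < q" "b q = succ_pm (b p)"
    using lt pq by auto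
  ultimately show False
    using b pq unfolding tops_def by blast
qed

text \<open>One step down a contracted cover changes neither which avoiders lie below nor which dual
  avoiders lie above. The former uses the obstruction at \<open>x\<close>, the latter the same
  obstruction seen from \<open>y\<close>.\<close>

lemma contract_descent:
  assumes x: "x \<in> admissible" "x \<notin> bottoms"
  obtains y where "y \<in> admissible" "invs n y \<subset> invs n x"
    "\<And>a. a \<in> bottoms \<Longrightarrow> invs n a \<subseteq> invs n x \<Longrightarrow> invs n a \<subseteq> invs n y"
    "\<And>b. b \<in> tops \<Longrightarrow> invs n y \<subseteq> invs n b \<Longrightarrow> invs n x \<subseteq> invs n b"
proof -
  have xH: "x \<in> hyperoctahedral n"
    using x by (simp add: admissible_def)
  obtain i k where ik: "i \<in> pm n" "k \<in> pm n" "i < k" and succ: "x i = succ_pm (x k)"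
    and obs: "obstructed (invs n x) i k"
    using x by (auto simp: bottoms_def)
  define y where "y = adj_swap (x k) \<circ> x"
  note desc = invs_adj_swap_descent[OF xH ik succ, folded y_def]
  have obs_y: "obstructed (invs n y) i k"
    using obs ik by (subst obstructed_cong[of _ _ _ "invs n x"]) (auto simp: desc(2))
  show thesis
  proof
    show "y \<in> admissible"
      using desc(1,2) x by (auto simp: admissible_def)
    show "invs n y \<subset> invs n x"
      using desc(2,3) by blast
    fix a assume a: "a \<in> bottoms" "invs n a \<subseteq> invs n x"
    then have "(i, k) \<notin> invs n a"
      using bottoms_skip_obstructed_descent[OF xH ik succ obs] by blast
    moreover have "a \<in> hyperoctahedral n"
      using a by (simp add: bottoms_def admissible_def)
    ultimately show "invs n a \<subseteq> invs n y"
      using a desc(2) invs_uminus[of a n k i] by auto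
  next
    fix b assume b: "b \<in> tops" "invs n y \<subseteq> invs n b"
    then have "(i, k) \<in> invs n b"
      using tops_contain_obstructed_ascent[OF desc(1) ik desc(5) obs_y] by blast
    moreover have "b \<in> hyperoctahedral n"
      using b by (simp add: tops_def admissible_def)
    ultimately show "invs n x \<subseteq> invs n b"
      using b desc(2) invs_uminus[of b n k i] by auto
  qed
qed

lemma contract_ascent:
  assumes y: "y \<in> admissible" "y \<notin> tops"
  obtains x where "x \<in> admissible" "invs n y \<subset> invs n x"
    "\<And>a. a \<in> bottoms \<Longrightarrow> invs n a \<subseteq> invs n x \<Longrightarrow> invs n a \<subseteq> invs n y"
    "\<And>b. b \<in> tops \<Longrightarrow> invs n y \<subseteq> invs n b \<Longrightarrow> invs n x \<subseteq> invs n b"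
proof -
  have yH: "y \<in> hyperoctahedral n"
    using y by (simp add: admissible_def)
  obtain i k where ik: "i \<in> pm n" "k \<in> pm n" "i < k" and succ: "y k = succ_pm (y i)"
    and obs: "obstructed (invs n y) i k"
    using y by (auto simp: tops_def)
  define x where "x = adj_swap (y i) \<circ> y"
  note asc = invs_adj_swap_ascent[OF yH ik succ, folded x_def]
  have obs_x: "obstructed (invs n x) i k"
    using obs ik by (subst obstructed_cong[of _ _ _ "invs n y"]) (auto simp: asc(2))
  have succ_x: "x i = succ_pm (x k)"
    using succ less_succ_pm[of "y i"] by (auto simp: x_def adj_swap_def)
  \<comment> \<open>The new inversion is admissible because a cut next to the obstructing position
    also separates \<open>i\<close> from \<open>k\<close>.\<close>
  have D_ik: "D i k"
    using obs D_widen unfolding obstructed_def by (meson less_imp_le order_refl)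
  show thesis
  proof
    show "x \<in> admissible"
      using asc(1,2) y D_ik D_uminus by (auto simp: admissible_def)
    show "invs n y \<subset> invs n x"
      using asc(2,3) by blast
    fix a assume a: "a \<in> bottoms" "invs n a \<subseteq> invs n x"
    then have "(i, k) \<notin> invs n a"
      using bottoms_skip_obstructed_descent[OF asc(1) ik succ_x obs_x] by blast
    moreover have "a \<in> hyperoctahedral n"
      using a by (simp add: bottoms_def admissible_def)
    ultimately show "invs n a \<subseteq> invs n y"
      using a asc(2) invs_uminus[of a n k i] by auto
  next
    fix b assume b: "b \<in> tops" "invs n y \<subseteq> invs n b"
    then have "(i, k) \<in> invs n b"
      using tops_contain_obstructed_ascent[OF yH ik succ obs] by blast
    moreover have "b \<in> hyperoctahedral n"
      using b by (simp add: tops_def admissible_def)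
    ultimately show "invs n x \<subseteq> invs n b"
      using b asc(2) invs_uminus[of b n k i] by auto
  qed
qed

text \<open>The invariants of single steps compose, so wherever a descent ends, all three properties
  hold. Being the greatest avoider below \<open>x\<close>, its end does not depend on the covers
  chosen.\<close>

lemma ex_bottom:
  assumes "x \<in> admissible"
  shows "\<exists>d\<in>bottoms. invs n d \<subseteq> invs n x \<and>
    (\<forall>a\<in>bottoms. invs n a \<subseteq> invs n x \<longrightarrow> invs n a \<subseteq> invs n d) \<and>
    (\<forall>b\<in>tops. invs n d \<subseteq> invs n b \<longrightarrow> invs n x \<subseteq> invs n b)"
  using assms
proof (induction "card (invs n x)" arbitrary: x rule: less_induct)
  case less
  show ?case
  proof (cases "x \<in> bottoms")
    case True
    then show ?thesis
      by blast
  next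
    case False
    with less.prems obtain y where y: "y \<in> admissible" "invs n y \<subset> invs n x"
      "\<And>a. a \<in> bottoms \<Longrightarrow> invs n a \<subseteq> invs n x \<Longrightarrow> invs n a \<subseteq> invs n y"
      "\<And>b. b \<in> tops \<Longrightarrow> invs n y \<subseteq> invs n b \<Longrightarrow> invs n x \<subseteq> invs n b"
      using contract_descent by metis
    have "card (invs n y) < card (invs n x)"
      using y(2) by (intro psubset_card_mono finite_invs)
    from less.hyps[OF this y(1)] obtain d where d: "d \<in> bottoms" "invs n d \<subseteq> invs n y"
      "\<And>a. a \<in> bottoms \<Longrightarrow> invs n a \<subseteq> invs n y \<Longrightarrow> invs n a \<subseteq> invs n d"
      "\<And>b. b \<in> tops \<Longrightarrow> invs n d \<subseteq> invs n b \<Longrightarrow> invs n y \<subseteq> invs n b"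
      by blast
    show ?thesis
    proof (rule bexI[OF _ d(1)], intro conjI ballI impI)
      show "invs n d \<subseteq> invs n x"
        using d(2) y(2) by simp
    qed (simp_all add: d y)
  qed
qed

lemma ex_top:
  assumes "y \<in> admissible"
  shows "\<exists>c\<in>tops. invs n y \<subseteq> invs n c \<and>
    (\<forall>b\<in>tops. invs n y \<subseteq> invs n b \<longrightarrow> invs n c \<subseteq> invs n b) \<and>
    (\<forall>a\<in>bottoms. invs n a \<subseteq> invs n c \<longrightarrow> invs n a \<subseteq> invs n y)"
  using assms
proof (induction "card (pm n \<times> pm n - invs n y)" arbitrary: y rule: less_induct)
  case less
  show ?case
  proof (cases "y \<in> tops")
    case True
    then show ?thesis
      by blast
  next
    case False
    with less.prems obtain x where x: "x \<in> admissible" "invs n y \<subset> invs n x"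
      "\<And>a. a \<in> bottoms \<Longrightarrow> invs n a \<subseteq> invs n x \<Longrightarrow> invs n a \<subseteq> invs n y"
      "\<And>b. b \<in> tops \<Longrightarrow> invs n y \<subseteq> invs n b \<Longrightarrow> invs n x \<subseteq> invs n b"
      using contract_ascent by metis
    have "invs n x \<subseteq> pm n \<times> pm n"
      by (auto simp: invs_def)
    then have "card (pm n \<times> pm n - invs n x) < card (pm n \<times> pm n - invs n y)"
      using x(2) by (intro psubset_card_mono) (auto simp: finite_pm)
    from less.hyps[OF this x(1)] obtain c where c: "c \<in> tops" "invs n x \<subseteq> invs n c"
      "\<And>b. b \<in> tops \<Longrightarrow> invs n x \<subseteq> invs n b \<Longrightarrow> invs n c \<subseteq> invs n b"
      "\<And>a. a \<in> bottoms \<Longrightarrow> invs n a \<subseteq> invs n c \<Longrightarrow> invs n a \<subseteq> invs n x"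
      by blast
    show ?thesis
    proof (rule bexI[OF _ c(1)], intro conjI ballI impI)
      show "invs n y \<subseteq> invs n c"
        using c(2) x(2) by simp
    qed (simp_all add: c x)
  qed
qed

lemma bottoms_quotient:
  obtains \<Theta> where "lattice_congruence (weak_order_on n admissible) \<Theta>"
    "order_isomorphic (quotient_lattice (weak_order_on n admissible) \<Theta>) (weak_order_on n bottoms)"
proof -
  have sub: "bottoms \<subseteq> admissible" "tops \<subseteq> admissible"
    by (auto simp: bottoms_def tops_def)
  obtain d where d: "\<And>x. x \<in> admissible \<Longrightarrow> d x \<in> bottoms \<and> invs n (d x) \<subseteq> invs n x \<and>
    (\<forall>a\<in>bottoms. invs n a \<subseteq> invs n x \<longrightarrow> invs n a \<subseteq> invs n (d x)) \<and>
    (\<forall>b\<in>tops. invs n (d x) \<subseteq> invs n b \<longrightarrow> invs n x \<subseteq> invs n b)"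
    using ex_bottom by metis
  obtain c where c: "\<And>x. x \<in> admissible \<Longrightarrow> c x \<in> tops \<and> invs n x \<subseteq> invs n (c x) \<and>
    (\<forall>b\<in>tops. invs n x \<subseteq> invs n b \<longrightarrow> invs n (c x) \<subseteq> invs n b) \<and>
    (\<forall>a\<in>bottoms. invs n a \<subseteq> invs n (c x) \<longrightarrow> invs n a \<subseteq> invs n x)"
    using ex_top by metis
  let ?L = "weak_order_on n admissible"
  have sel: "carrier ?L = admissible" "le ?L = weak_le n"
    by (simp_all add: weak_order_on_def)
  have w: "weak_le n u v \<longleftrightarrow> invs n u \<subseteq> invs n v"
    if "u \<in> admissible \<or> u \<in> bottoms \<or> u \<in> tops" "v \<in> admissible \<or> v \<in> bottoms \<or> v \<in> tops" for u v
    using that sub admissible_weak_le_iff by blast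
  have d': "d x \<in> bottoms \<and> d x \<sqsubseteq>\<^bsub>?L\<^esub> x \<and>
      (\<forall>a\<in>bottoms. a \<sqsubseteq>\<^bsub>?L\<^esub> x \<longrightarrow> a \<sqsubseteq>\<^bsub>?L\<^esub> d x) \<and> (\<forall>b\<in>tops. d x \<sqsubseteq>\<^bsub>?L\<^esub> b \<longrightarrow> x \<sqsubseteq>\<^bsub>?L\<^esub> b)"
    if "x \<in> carrier ?L" for x
    using d[of x] that by (simp add: sel w)
  have c': "c x \<in> tops \<and> x \<sqsubseteq>\<^bsub>?L\<^esub> c x \<and>
      (\<forall>b\<in>tops. x \<sqsubseteq>\<^bsub>?L\<^esub> b \<longrightarrow> c x \<sqsubseteq>\<^bsub>?L\<^esub> b) \<and> (\<forall>a\<in>bottoms. a \<sqsubseteq>\<^bsub>?L\<^esub> c x \<longrightarrow> a \<sqsubseteq>\<^bsub>?L\<^esub> x)"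
    if "x \<in> carrier ?L" for x
    using c[of x] that by (simp add: sel w)
  have sub': "bottoms \<subseteq> carrier ?L" "tops \<subseteq> carrier ?L"
    using sub by (simp_all add: sel)
  have bot: "weak_order_on n bottoms = \<lparr>carrier = bottoms, eq = (=), le = le ?L\<rparr>"
    by (simp add: weak_order_on_def)
  show ?thesis
    using congruence_from_projections[OF lattice_admissible sub' d' c', folded bot] by (rule that)
qed

section \<open>Avoidance in terms of values\<close>

lemma obstructed_descent_iff:
  assumes \<pi>: "\<pi> \<in> hyperoctahedral n" and i: "i \<in> pm n" and k: "k \<in> pm n"
    and succ: "\<pi> i = succ_pm (\<pi> k)"
  shows "obstructed (invs n \<pi>) i k \<longleftrightarrow> (\<exists>j\<in>pm n. i < j \<and> j < k \<and> D i j \<and> D j k \<and>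
    (E j \<and> \<pi> i < \<pi> j \<or> \<not> E j \<and> \<pi> j < \<pi> k))"
proof -
  have "(if E j then (i, j) \<notin> invs n \<pi> \<and> (j, k) \<in> invs n \<pi> else (i, j) \<in> invs n \<pi> \<and> (j, k) \<notin> invs n \<pi>)
    \<longleftrightarrow> (E j \<and> \<pi> i < \<pi> j \<or> \<not> E j \<and> \<pi> j < \<pi> k)" if "j \<in> pm n" "i < j" "j < k" for j
    using invs_iff_not_less[OF \<pi> i that(1,2)] invs_iff_not_less[OF \<pi> that(1) k that(3)]
      succ less_succ_pm[of "\<pi> k"] hyperoctahedral_eq_iff[OF \<pi>, of i j]
      hyperoctahedral_eq_iff[OF \<pi>, of j k] that by (auto simp: not_less)
  then show ?thesis
    unfolding obstructed_def by blast
qed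

text \<open>Negation turns a pattern at \<open>i\<close>, \<open>j\<close>, \<open>k\<close> into
  one at \<open>- k\<close>, \<open>- j\<close>, \<open>- i\<close>: it swaps above with below, and
  \<open>E\<close> flips along. So a pattern with any middle position yields one with
  \<open>0 < j\<close>.\<close>

lemma bottoms_iff:
  "\<pi> \<in> bottoms \<longleftrightarrow> \<pi> \<in> admissible \<and> \<not> (\<exists>i j k. i \<in> pm n \<and> j \<in> pm n \<and> k \<in> pm n \<and> i < j \<and> j < k \<and>
    D i j \<and> D j k \<and> 0 < j \<and> \<pi> i = succ_pm (\<pi> k) \<and> (E j \<and> \<pi> i < \<pi> j \<or> \<not> E j \<and> \<pi> j < \<pi> k))"
  (is "_ \<longleftrightarrow> _ \<and> \<not> ?pattern")
proof (cases "\<pi> \<in> admissible")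
  case True
  then have \<pi>: "\<pi> \<in> hyperoctahedral n"
    by (rule admissible_hyperoctahedral)
  have "\<pi> \<in> bottoms \<longleftrightarrow> \<not> (\<exists>i\<in>pm n. \<exists>k\<in>pm n. i < k \<and> \<pi> i = succ_pm (\<pi> k) \<and>
    (\<exists>j\<in>pm n. i < j \<and> j < k \<and> D i j \<and> D j k \<and> (E j \<and> \<pi> i < \<pi> j \<or> \<not> E j \<and> \<pi> j < \<pi> k)))"
    using True obstructed_descent_iff[OF \<pi>] unfolding bottoms_def by blast
  also have "\<dots> \<longleftrightarrow> \<not> ?pattern"
  proof (intro arg_cong[of _ _ Not] iffI)
    assume "\<exists>i\<in>pm n. \<exists>k\<in>pm n. i < k \<and> \<pi> i = succ_pm (\<pi> k) \<and>
      (\<exists>j\<in>pm n. i < j \<and> j < k \<and> D i j \<and> D j k \<and> (E j \<and> \<pi> i < \<pi> j \<or> \<not> E j \<and> \<pi> j < \<pi> k))"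
    then obtain i j k where ijk: "i \<in> pm n" "j \<in> pm n" "k \<in> pm n" "i < j" "j < k" "D i j" "D j k"
      "\<pi> i = succ_pm (\<pi> k)" "E j \<and> \<pi> i < \<pi> j \<or> \<not> E j \<and> \<pi> j < \<pi> k"
      by blast
    show ?pattern
    proof (cases "0 < j")
      case True
      then show ?thesis
        using ijk by blast
    next
      case False
      have "\<pi> k \<noteq> 0"
        using \<pi> ijk by (metis hyperoctahedral_mem_pm mem_pm)
      then have "\<pi> (- k) = succ_pm (\<pi> (- i))"
        using ijk by (simp add: hyperoctahedral_uminus[OF \<pi>] succ_pm_uminus_succ_pm)
      moreover have "E (- j) \<and> \<pi> (- k) < \<pi> (- j) \<or> \<not> E (- j) \<and> \<pi> (- j) < \<pi> (- i)"
        using ijk by (auto simp: hyperoctahedral_uminus[OF \<pi>] E_uminus)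
      moreover have "0 < - j"
        using False ijk by (auto simp: mem_pm)
      ultimately show ?thesis
        using ijk D_uminus
        by (intro exI[of _ "- k"] exI[of _ "- j"] exI[of _ "- i"]) auto
    qed
  next
    assume ?pattern
    then show "\<exists>i\<in>pm n. \<exists>k\<in>pm n. i < k \<and> \<pi> i = succ_pm (\<pi> k) \<and>
      (\<exists>j\<in>pm n. i < j \<and> j < k \<and> D i j \<and> D j k \<and> (E j \<and> \<pi> i < \<pi> j \<or> \<not> E j \<and> \<pi> j < \<pi> k))"
      by (meson less_trans)
  qed
  finally show ?thesis
    using True by blast
next
  case False
  then show ?thesis
    by (simp add: bottoms_def)
qed

end

section \<open>Compositions and blocks\<close>

text \<open>The indices of the generators in \<open>J_gens \<alpha>\<close>. An index
  \<open>c\<close> marks the gap after position \<open>c\<close>, and 0 the gap between -1 and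
  1.\<close>

definition cuts :: "nat list \<Rightarrow> nat set"
  where "cuts \<alpha> = psum \<alpha> ` {1..<length (parts \<alpha>)} \<union> (if is_split \<alpha> then {0} else {})"

text \<open>The second disjunct is the mirrored gap just before \<open>- c\<close>, that is
  \<open>i < - int c\<close> and \<open>- int c \<le> k\<close>. In this form, negating and swapping
  the arguments exchanges the disjuncts.\<close>

definition cut_between :: "nat list \<Rightarrow> int \<Rightarrow> int \<Rightarrow> bool"
  where "cut_between \<alpha> i k \<longleftrightarrow> (\<exists>c\<in>cuts \<alpha>. i \<le> int c \<and> int c < k \<or> - k \<le> int c \<and> int c < - i)"

lemma cut_between_widen:
  assumes "cut_between \<alpha> i k" "i' \<le> i" "k \<le> k'"
  shows "cut_between \<alpha> i' k'"
proof -
  obtain c where "c \<in> cuts \<alpha>" "i \<le> int c \<and> int c < k \<or> - k \<le> int c \<and> int c < - i"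
    using assms(1) unfolding cut_between_def by blast
  moreover from this have "i' \<le> int c \<and> int c < k' \<or> - k' \<le> int c \<and> int c < - i'"
    using assms(2,3) by linarith
  ultimately show ?thesis
    unfolding cut_between_def by blast
qed

lemma cut_between_uminus: "cut_between \<alpha> (- k) (- i) \<longleftrightarrow> cut_between \<alpha> i k"
  by (auto simp: cut_between_def)

lemma J_gens_eq: "J_gens \<alpha> = simple_gen ` cuts \<alpha>"
  by (auto simp: J_gens_def cuts_def)

lemma inj_simple_gen: "inj simple_gen"
proof (rule injI)
  have *: "x \<noteq> y \<Longrightarrow> simple_gen x \<noteq> simple_gen y" if "x < y" for x y
  proof
    assume "simple_gen x = simple_gen y"
    \<comment> \<open>Compare both sides at a point that the smaller generator moves:
      \<open>x\<close>, or 1 if \<open>x = 0\<close>.\<close>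
    then have "adj_swap (if x = 0 then - 1 else int x) (if x = 0 then 1 else int x)
      = adj_swap (int y) (if x = 0 then 1 else int x)"
      using that by (simp add: simple_gen_eq_adj_swap fun_eq_iff)
    then show False
      using that by (auto simp: adj_swap_def succ_pm_def split: if_splits)
  qed
  fix x y assume "simple_gen x = simple_gen y"
  then show "x = y"
    using *[of x y] *[of y x] by (metis linorder_neqE_nat)
qed

text \<open>The length condition asks for an ascent at every adjacent gap that is not a cut. Any
  inversion contains an adjacent descent between its positions, so the condition on adjacent gaps
  governs all inversions.\<close>

lemma parabolic_quotient_iff:
  "\<pi> \<in> parabolic_quotient n \<alpha> \<longleftrightarrow> \<pi> \<in> hyperoctahedral n \<and> (\<forall>(i, k)\<in>invs n \<pi>. cut_between \<alpha> i k)"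
proof (cases "\<pi> \<in> hyperoctahedral n")
  case \<pi>: True
  define e where "e m = (if m = 0 then - 1 else int m)" for m :: nat
  have e: "e m \<in> pm n" "succ_pm (e m) \<in> pm n" "simple_gen m = adj_swap (e m)" if "m < n" for m
    using that by (auto simp: e_def mem_pm succ_pm_def simple_gen_eq_adj_swap)
  have gens: "simple_gens n - J_gens \<alpha> = simple_gen ` ({..<n} - cuts \<alpha>)"
    unfolding simple_gens_def J_gens_eq by (simp add: image_set_diff[OF inj_simple_gen])
  have "\<pi> \<in> parabolic_quotient n \<alpha> \<longleftrightarrow> (\<forall>m\<in>{..<n} - cuts \<alpha>. \<pi> (e m) < \<pi> (succ_pm (e m)))"
    unfolding parabolic_quotient_def gens using \<pi> e cox_length_mult_adj_swap[OF \<pi>] by auto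
  also have "\<dots> \<longleftrightarrow> (\<forall>(i, k)\<in>invs n \<pi>. cut_between \<alpha> i k)"
  proof
    assume asc: "\<forall>m\<in>{..<n} - cuts \<alpha>. \<pi> (e m) < \<pi> (succ_pm (e m))"
    have adj: "cut_between \<alpha> w (succ_pm w)"
      if w: "w \<in> pm n" "succ_pm w \<in> pm n" "\<pi> (succ_pm w) < \<pi> w" for w
    proof (rule ccontr)
      assume ncut: "\<not> cut_between \<alpha> w (succ_pm w)"
      \<comment> \<open>The generator that belongs to the gap after \<open>w\<close>; for
        \<open>w < -1\<close> it is found through the mirror gap.\<close>
      define m where "m = (if w = - 1 then 0 else if w > 0 then nat w else nat (- succ_pm w))"
      have "m < n"
        using w by (auto simp: m_def mem_pm succ_pm_def)
      moreover have "m \<notin> cuts \<alpha>"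
        using ncut w by (auto simp: m_def cut_between_def mem_pm succ_pm_def split: if_splits)
      ultimately have lt: "\<pi> (e m) < \<pi> (succ_pm (e m))"
        using asc by blast
      have "e m = w \<or> e m = - succ_pm w"
        using w by (auto simp: e_def m_def mem_pm succ_pm_def)
      then show False
      proof
        assume "e m = w"
        then show False
          using lt w by simp
      next
        assume "e m = - succ_pm w"
        then show False
          using lt w by (simp add: succ_pm_uminus_succ_pm mem_pm hyperoctahedral_uminus[OF \<pi>])
      qed
    qed
    show "\<forall>(i, k)\<in>invs n \<pi>. cut_between \<alpha> i k"
    proof clarify
      fix i k assume "(i, k) \<in> invs n \<pi>"
      then have ik: "i \<in> pm n" "k \<in> pm n" "i < k" "\<pi> k < \<pi> i"
        by (auto simp: invs_def)
      \<comment> \<open>The values fall below \<open>\<pi> i\<close> somewhere on the way from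
        \<open>i\<close> to \<open>k\<close>; where they do, there is an adjacent descent.\<close>
      then obtain w where "w \<in> pm n" "succ_pm w \<in> pm n" "i \<le> w" "succ_pm w \<le> k"
        "\<pi> i \<le> \<pi> w" "\<not> \<pi> i \<le> \<pi> (succ_pm w)"
        using pm_walk[of i n k "\<lambda>w. \<pi> i \<le> \<pi> w"] by auto
      then show "cut_between \<alpha> i k"
        using adj[of w] cut_between_widen by (meson less_le_trans not_le)
    qed
  next
    assume cut: "\<forall>(i, k)\<in>invs n \<pi>. cut_between \<alpha> i k"
    show "\<forall>m\<in>{..<n} - cuts \<alpha>. \<pi> (e m) < \<pi> (succ_pm (e m))"
    proof
      fix m assume m: "m \<in> {..<n} - cuts \<alpha>"
      have "\<not> cut_between \<alpha> (e m) (succ_pm (e m))"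
      proof
        assume "cut_between \<alpha> (e m) (succ_pm (e m))"
        then obtain c where "c \<in> cuts \<alpha>" "c = m"
          by (auto simp: cut_between_def e_def succ_pm_def split: if_splits)
        then show False
          using m by simp
      qed
      then have "(e m, succ_pm (e m)) \<notin> invs n \<pi>"
        using cut by blast
      then show "\<pi> (e m) < \<pi> (succ_pm (e m))"
        using e[of m] m less_succ_pm[of "e m"] invs_iff_not_less[OF \<pi>, of "e m" "succ_pm (e m)"] by simp
    qed
  qed
  finally show ?thesis
    using \<pi> by simp
next
  case False
  then show ?thesis
    by (simp add: parabolic_quotient_def)
qed

section \<open>Blocks as sets of positions without a cut between them\<close>

locale composition =
  fixes n :: nat and \<alpha> :: "nat list"
  assumes n: "n \<ge> 1" and \<alpha>: "typeB_composition n \<alpha>"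
begin

abbreviation "r \<equiv> length (parts \<alpha>)"

lemma parts_pos: "a \<in> set (parts \<alpha>) \<Longrightarrow> 0 < a"
  using \<alpha> by (cases \<alpha>) (auto simp: parts_def is_split_def typeB_composition_def split: if_splits)

lemma sum_parts: "sum_list (parts \<alpha>) = n"
  using \<alpha> by (cases \<alpha>) (auto simp: parts_def is_split_def typeB_composition_def)

lemma psum_0: "psum \<alpha> 0 = 0"
  and psum_r: "psum \<alpha> r = n"
  by (simp_all add: psum_def sum_parts)

lemma r_pos: "0 < r"
  using sum_parts n by (cases "parts \<alpha>") auto

lemma psum_less: "i < j \<Longrightarrow> j \<le> r \<Longrightarrow> psum \<alpha> i < psum \<alpha> j"
proof (induction j)
  case (Suc j)
  then have "psum \<alpha> (Suc j) = psum \<alpha> j + parts \<alpha> ! j" "0 < parts \<alpha> ! j"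
    using parts_pos by (auto simp: psum_def take_Suc_conv_app_nth)
  then show ?case
    using Suc by (cases "i = j") auto
qed simp

lemma psum_less_iff: "i \<le> r \<Longrightarrow> j \<le> r \<Longrightarrow> psum \<alpha> i < psum \<alpha> j \<longleftrightarrow> i < j"
  using psum_less[of i j] psum_less[of j i] by (cases i j rule: linorder_cases) auto

text \<open>Describes blocks by cuts instead of indices of parts; \<open>min\<close> and
  \<open>max\<close> supply the order of arguments that \<open>cut_between\<close> expects.\<close>

definition block_of :: "int \<Rightarrow> int set"
  where "block_of x = {y \<in> pm n. \<not> cut_between \<alpha> (min x y) (max x y)}"

lemma block_of_uminus: "- y \<in> block_of (- x) \<longleftrightarrow> y \<in> block_of x"
proof -
  have "min (- x) (- y) = - max x y" "max (- x) (- y) = - min x y"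
    by auto
  then show ?thesis
    by (simp add: block_of_def cut_between_uminus)
qed

lemma uminus_mem_pos_block: "- y \<in> pos_block \<alpha> a \<longleftrightarrow> y \<in> neg_block \<alpha> a"
  by (auto simp: pos_block_def neg_block_def)

text \<open>Partial sums increase strictly, so no cut lies strictly inside, and each end is a cut or
  the outer bound \<open>n\<close>. The first block of a join composition is left out, as no cut at
  0 closes it off below.\<close>

lemma pos_block_eq_block_of:
  assumes a: "1 \<le> a" "a \<le> r" "is_split \<alpha> \<or> a \<noteq> 1" and x: "x \<in> pos_block \<alpha> a"
  shows "pos_block \<alpha> a = block_of x"
proof (intro equalityI subsetI)
  have bound: "psum \<alpha> a \<le> n"
    using psum_less_iff[of r a] a psum_r by (auto simp: not_less[symmetric])
  fix y assume y: "y \<in> pos_block \<alpha> a"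
  have "\<not> (min x y \<le> int c \<and> int c < max x y \<or> - max x y \<le> int c \<and> int c < - min x y)"
    if c: "c \<in> cuts \<alpha>" for c
  proof
    assume H: "min x y \<le> int c \<and> int c < max x y \<or> - max x y \<le> int c \<and> int c < - min x y"
    then have "psum \<alpha> (a - 1) < c" "c < psum \<alpha> a"
      using x y by (auto simp: pos_block_def min_def max_def split: if_splits)
    moreover from this c obtain b where "c = psum \<alpha> b" "b < r"
      by (auto simp: cuts_def split: if_splits)
    moreover have "a - 1 \<le> r"
      using a by simp
    ultimately have "a - 1 < b" "b < a"
      using psum_less_iff[of b a] psum_less_iff[of "a - 1" b] a by simp_all
    then show False
      by simp
  qed
  then show "y \<in> block_of x"
    using y bound by (auto simp: block_of_def cut_between_def pos_block_def mem_pm)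
next
  fix y assume y: "y \<in> block_of x"
  have c1: "psum \<alpha> a \<in> cuts \<alpha>" if "a < r"
    using that a by (auto simp: cuts_def)
  have c2: "psum \<alpha> (a - 1) \<in> cuts \<alpha>"
  proof (cases "a = 1")
    case True
    then show ?thesis
      using a psum_0 by (auto simp: cuts_def)
  next
    case False
    then show ?thesis
      using a unfolding cuts_def by (intro UnI1 imageI) auto
  qed
  have "y \<le> int (psum \<alpha> a)"
  proof (rule ccontr)
    assume H: "\<not> ?thesis"
    then have "a < r"
      using y psum_r a by (cases "a = r") (auto simp: block_of_def mem_pm)
    then show False
      using H c1 x y by (auto simp: block_of_def cut_between_def pos_block_def min_def max_def)
  qed
  moreover have "int (psum \<alpha> (a - 1)) < y"
  proof (rule ccontr)
    assume "\<not> ?thesis"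
    then show False
      using c2 x y by (auto simp: block_of_def cut_between_def pos_block_def min_def max_def)
  qed
  ultimately show "y \<in> pos_block \<alpha> a"
    by (simp add: pos_block_def)
qed

lemma neg_block_eq_block_of:
  assumes "1 \<le> a" "a \<le> r" "is_split \<alpha> \<or> a \<noteq> 1" "x \<in> neg_block \<alpha> a"
  shows "neg_block \<alpha> a = block_of x"
proof -
  have "pos_block \<alpha> a = block_of (- x)"
    using assms by (intro pos_block_eq_block_of) (auto simp: uminus_mem_pos_block)
  then show ?thesis
    using block_of_uminus uminus_mem_pos_block by blast
qed

text \<open>All cuts of a join composition are at least \<open>psum \<alpha> 1\<close>, so positions
  up to that absolute value are not separated, whatever their signs.\<close>

lemma middle_block_eq_block_of:
  assumes join: "\<not> is_split \<alpha>" and x: "x \<in> {- int (psum \<alpha> 1)..int (psum \<alpha> 1)} - {0}"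
  shows "{- int (psum \<alpha> 1)..int (psum \<alpha> 1)} - {0} = block_of x"
proof (intro equalityI subsetI)
  have bound: "psum \<alpha> 1 \<le> n"
    using psum_less_iff[of r 1] r_pos psum_r by (auto simp: not_less[symmetric])
  fix y assume y: "y \<in> {- int (psum \<alpha> 1)..int (psum \<alpha> 1)} - {0}"
  have "psum \<alpha> 1 \<le> c" if "c \<in> cuts \<alpha>" for c
    using that join psum_less_iff[of _ 1] r_pos by (force simp: cuts_def not_less[symmetric])
  moreover have "\<not> (min x y \<le> int c \<and> int c < max x y \<or> - max x y \<le> int c \<and> int c < - min x y)"
    if "psum \<alpha> 1 \<le> c" for c
    using that x y by (auto simp: min_def max_def)
  ultimately have "\<not> cut_between \<alpha> (min x y) (max x y)"
    unfolding cut_between_def by blast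
  then show "y \<in> block_of x"
    using y bound by (auto simp: block_of_def mem_pm)
next
  fix y assume y: "y \<in> block_of x"
  have "\<bar>y\<bar> \<le> int (psum \<alpha> 1)"
  proof (rule ccontr)
    assume H: "\<not> ?thesis"
    \<comment> \<open>With a single part there is no cut, but then
      \<open>psum \<alpha> 1 = n\<close> and no position lies beyond.\<close>
    then have "r \<noteq> 1"
      using y psum_r by (auto simp: block_of_def mem_pm)
    then have "1 < r"
      using r_pos by linarith
    then have "psum \<alpha> 1 \<in> cuts \<alpha>"
      by (auto simp: cuts_def)
    then show False
      using H x y by (auto simp: block_of_def cut_between_def min_def max_def split: if_splits)
  qed
  then show "y \<in> {- int (psum \<alpha> 1)..int (psum \<alpha> 1)} - {0}"
    using y by (auto simp: block_of_def mem_pm)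
qed

lemma Part_eq_block_of:
  assumes "B \<in> Part \<alpha>" "x \<in> B"
  shows "B = block_of x"
proof (cases "is_split \<alpha>")
  case True
  then have "B \<in> pos_block \<alpha> ` {1..r} \<union> neg_block \<alpha> ` {1..r}"
    using assms(1) by (simp add: Part_def)
  then show ?thesis
  proof (elim UnE imageE)
    fix a assume "B = pos_block \<alpha> a" "a \<in> {1..r}"
    then show "B = block_of x"
      using pos_block_eq_block_of[of a x] assms(2) True by simp
  next
    fix a assume "B = neg_block \<alpha> a" "a \<in> {1..r}"
    then show "B = block_of x"
      using neg_block_eq_block_of[of a x] assms(2) True by simp
  qed
next
  case False
  then have "B \<in> {{- int (psum \<alpha> 1)..int (psum \<alpha> 1)} - {0}} \<union> pos_block \<alpha> ` {2..r} \<union> neg_block \<alpha> ` {2..r}"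
    using assms(1) unfolding Part_def by (simp only: if_False)
  then show ?thesis
  proof (elim UnE imageE singletonE)
    assume B: "B = {- int (psum \<alpha> 1)..int (psum \<alpha> 1)} - {0}"
    show "B = block_of x"
      using middle_block_eq_block_of[OF False] assms(2) unfolding B by (simp only:)
  next
    fix a assume "B = pos_block \<alpha> a" "a \<in> {2..r}"
    then show "B = block_of x"
      using pos_block_eq_block_of[of a x] assms(2) by simp
  next
    fix a assume "B = neg_block \<alpha> a" "a \<in> {2..r}"
    then show "B = block_of x"
      using neg_block_eq_block_of[of a x] assms(2) by simp
  qed
qed

lemma pos_in_Part:
  assumes "x \<in> pm n" "0 < x"
  shows "\<exists>a\<in>{1..r}. x \<in> pos_block \<alpha> a"
proof -
  define a where "a = (LEAST a. x \<le> int (psum \<alpha> a))"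
  have r: "x \<le> int (psum \<alpha> r)"
    using assms by (simp add: psum_r mem_pm)
  then have "x \<le> int (psum \<alpha> a)" "a \<le> r"
    unfolding a_def by (auto intro: LeastI Least_le)
  moreover have "a \<noteq> 0"
    using calculation assms psum_0 by (cases "a = 0") auto
  moreover from this have "\<not> x \<le> int (psum \<alpha> (a - 1))"
    using not_less_Least[of "a - 1" "\<lambda>a. x \<le> int (psum \<alpha> a)"] by (simp add: a_def)
  ultimately show ?thesis
    by (intro bexI[of _ a]) (auto simp: pos_block_def)
qed

lemma block_of_in_Part:
  assumes x: "x \<in> pm n"
  shows "block_of x \<in> Part \<alpha>" and "x \<in> block_of x"
proof -
  have "\<exists>B\<in>Part \<alpha>. x \<in> B"
  proof (cases "\<not> is_split \<alpha> \<and> \<bar>x\<bar> \<le> int (psum \<alpha> 1)")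
    case True
    then show ?thesis
      using x by (auto simp: Part_def mem_pm)
  next
    case False
    have "\<exists>a\<in>{1..r}. \<bar>x\<bar> \<in> pos_block \<alpha> a"
      using x by (intro pos_in_Part) (auto simp: mem_pm)
    then obtain a where a: "a \<in> {1..r}" "\<bar>x\<bar> \<in> pos_block \<alpha> a"
      by blast
    have "is_split \<alpha> \<or> a \<noteq> 1"
      using False a by (auto simp: pos_block_def)
    then have "pos_block \<alpha> a \<in> Part \<alpha>" "neg_block \<alpha> a \<in> Part \<alpha>"
      using a by (auto simp: Part_def)
    moreover have "x \<in> pos_block \<alpha> a \<or> x \<in> neg_block \<alpha> a"
      using a(2) by (auto simp: pos_block_def neg_block_def abs_if split: if_splits)
    ultimately show ?thesis
      by blast
  qed
  then show "block_of x \<in> Part \<alpha>" "x \<in> block_of x"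
    using Part_eq_block_of by auto
qed

lemma block_of_eq_iff:
  assumes "x \<in> pm n" "y \<in> pm n" "x < y"
  shows "block_of x = block_of y \<longleftrightarrow> \<not> cut_between \<alpha> x y"
proof -
  have "block_of x = block_of y \<longleftrightarrow> y \<in> block_of x"
    using block_of_in_Part(2)[OF assms(2)] Part_eq_block_of[OF block_of_in_Part(1)[OF assms(1)], of y] by auto
  then show ?thesis
    using assms by (simp add: block_of_def)
qed

text \<open>A cut between \<open>i\<close> and \<open>j\<close> also lies between \<open>i\<close>
  and \<open>k\<close>, so two separations already yield three pairwise different blocks.\<close>

lemma in_different_blocks_iff:
  assumes "i \<in> pm n" "j \<in> pm n" "k \<in> pm n" "i < j" "j < k"
  shows "in_different_blocks \<alpha> i j k \<longleftrightarrow> cut_between \<alpha> i j \<and> cut_between \<alpha> j k"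
proof -
  have "in_different_blocks \<alpha> i j k \<longleftrightarrow> block_of i \<noteq> block_of j \<and> block_of i \<noteq> block_of k \<and> block_of j \<noteq> block_of k"
  proof
    assume "in_different_blocks \<alpha> i j k"
    then obtain A B C where "A \<in> Part \<alpha>" "B \<in> Part \<alpha>" "C \<in> Part \<alpha>"
      "A \<noteq> B" "A \<noteq> C" "B \<noteq> C" "i \<in> A" "j \<in> B" "k \<in> C"
      unfolding in_different_blocks_def by (elim bexE conjE) (rule that)
    then show "block_of i \<noteq> block_of j \<and> block_of i \<noteq> block_of k \<and> block_of j \<noteq> block_of k"
      using Part_eq_block_of[of A i] Part_eq_block_of[of B j] Part_eq_block_of[of C k] by simp
  next
    assume "block_of i \<noteq> block_of j \<and> block_of i \<noteq> block_of k \<and> block_of j \<noteq> block_of k"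
    then show "in_different_blocks \<alpha> i j k"
      unfolding in_different_blocks_def using block_of_in_Part assms(1-3)
      by (intro bexI[of _ "block_of i"] bexI[of _ "block_of j"] bexI[of _ "block_of k"]) simp_all
  qed
  moreover have "i < k"
    using assms by simp
  ultimately show ?thesis
    using block_of_eq_iff[of i j] block_of_eq_iff[of j k] block_of_eq_iff[of i k] assms
      cut_between_widen[of \<alpha> i j i k] by auto
qed

text \<open>On positive positions this is read off from the patterns: below inside the first block
  of a join composition, above in all other cases. Negative positions get the opposite value, as
  \<open>E_uminus\<close> demands; in the join case the negative half of the first block thus
  obstructs above.\<close>

definition side :: "int \<Rightarrow> bool"
  where "side j \<longleftrightarrow>
    (if is_split \<alpha> then 0 < j else int (psum \<alpha> 1) < j \<or> - int (psum \<alpha> 1) \<le> j \<and> j < 0)"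

sublocale pattern_data n "cut_between \<alpha>" side
proof unfold_locales
  fix j assume "j \<in> pm n"
  then show "side (- j) \<longleftrightarrow> \<not> side j"
    by (auto simp: side_def mem_pm)
qed (auto simp: cut_between_uminus intro: cut_between_widen)

lemma parabolic_quotient_eq_admissible: "parabolic_quotient n \<alpha> = admissible"
  by (auto simp: parabolic_quotient_iff admissible_def)

text \<open>The two kinds of pattern differ in the clause on \<open>\<pi> j\<close>, and for
  \<open>0 < j\<close> this clause is what \<open>side\<close> prescribes.\<close>

lemma avoiders231_eq_bottoms: "avoiders231 n \<alpha> = bottoms"
proof -
  have split_iff: "split_pattern n \<alpha> \<pi> i j k \<longleftrightarrow>
    i \<in> pm n \<and> j \<in> pm n \<and> k \<in> pm n \<and> i < j \<and> j < k \<and> cut_between \<alpha> i j \<and> cut_between \<alpha> j k \<and>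
    0 < j \<and> \<pi> i = succ_pm (\<pi> k) \<and> (side j \<and> \<pi> i < \<pi> j \<or> \<not> side j \<and> \<pi> j < \<pi> k)"
    if "is_split \<alpha>" for \<pi> i j k
    using that in_different_blocks_iff[of i j k]
    by (cases "i \<in> pm n \<and> j \<in> pm n \<and> k \<in> pm n \<and> i < j \<and> j < k")
      (auto simp: split_pattern_def side_def)
  have join_iff: "join_pattern n \<alpha> \<pi> i j k \<longleftrightarrow>
    i \<in> pm n \<and> j \<in> pm n \<and> k \<in> pm n \<and> i < j \<and> j < k \<and> cut_between \<alpha> i j \<and> cut_between \<alpha> j k \<and>
    0 < j \<and> \<pi> i = succ_pm (\<pi> k) \<and> (side j \<and> \<pi> i < \<pi> j \<or> \<not> side j \<and> \<pi> j < \<pi> k)"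
    if "\<not> is_split \<alpha>" for \<pi> i j k
    using that in_different_blocks_iff[of i j k]
    by (cases "i \<in> pm n \<and> j \<in> pm n \<and> k \<in> pm n \<and> i < j \<and> j < k")
      (auto simp: join_pattern_def side_def)
  have "\<pi> \<in> avoiders231 n \<alpha> \<longleftrightarrow> \<pi> \<in> bottoms" for \<pi>
  proof (cases "is_split \<alpha>")
    case True
    show ?thesis
      unfolding avoiders231_def parabolic_quotient_eq_admissible bottoms_iff mem_Collect_eq if_P[OF True]
      by (intro conj_cong refl arg_cong[of _ _ Not] ex_cong1 split_iff True)
  next
    case False
    show ?thesis
      unfolding avoiders231_def parabolic_quotient_eq_admissible bottoms_iff mem_Collect_eq if_not_P[OF False]
      by (intro conj_cong refl arg_cong[of _ _ Not] ex_cong1 join_iff False)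
  qed
  then show ?thesis
    by blast
qed

end

theorem theorem1:
  fixes n :: nat and \<alpha> :: "nat list"
  assumes "n \<ge> 1" and "typeB_composition n \<alpha>"
  shows "lattice (Tam_B n \<alpha>) \<and>
    lattice (weak_order_on n (parabolic_quotient n \<alpha>)) \<and>
    (\<exists>\<Theta>. lattice_congruence (weak_order_on n (parabolic_quotient n \<alpha>)) \<Theta> \<and>
         order_isomorphic
           (quotient_lattice (weak_order_on n (parabolic_quotient n \<alpha>)) \<Theta>)
           (Tam_B n \<alpha>))"
proof -
  interpret composition n \<alpha>
    using assms by unfold_locales
  let ?L = "weak_order_on n (parabolic_quotient n \<alpha>)"
  have L: "lattice ?L"
    unfolding parabolic_quotient_eq_admissible by (rule lattice_admissible)
  obtain \<Theta> where \<Theta>: "lattice_congruence ?L \<Theta>"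
    "order_isomorphic (quotient_lattice ?L \<Theta>) (Tam_B n \<alpha>)"
    unfolding Tam_B_def parabolic_quotient_eq_admissible avoiders231_eq_bottoms by (rule bottoms_quotient)
  have "lattice (quotient_lattice ?L \<Theta>)"
    using L \<Theta>(1)
    by (intro lattice_with_congruence.lattice_quotient lattice_with_congruence.intro
        lattice_with_congruence_axioms.intro)
  \<comment> \<open>The Tamari poset inherits the lattice property from the quotient; no join of
    avoiders is constructed directly.\<close>
  then have "lattice (Tam_B n \<alpha>)"
    using \<Theta>(2) by (rule lattice_order_isomorphic) (simp add: Tam_B_def weak_order_on_def)
  with L \<Theta> show ?thesis
    by blast
qed

end
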